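(* Let $\omega$ be an open strict interval of $\mathbb T$ and let $T>0$. For every $k\in \mathbb N$, the set $\mathcal{NC}_{L^2}(\omega,T)\cap W^{k,2}(\mathbb T)$ is dense in $W^{k,2}(\mathbb T)$.
   Context: $\mathbb T$ is the complex unit circle, identified with $\mathbb R/2\pi\mathbb Z$ via $x\mapsto e^{ix}$. An open strict interval of $\mathbb T$ is an open arc $\{e^{ix}:a<x<b\}$ with $0<b-a<2\pi$. Functions are complex valued; $f\in L^2(\mathbb T)$ is written $f(e^{ix})=\sum_{n\in\mathbb Z}\widehat f(n)e^{inx}$. $W^{k,2}(\mathbb T)$ is the Sobolev space with scalar product $\langle f,g\rangle_{W^{k,2}(\mathbb T)}=\sum_{n\in\mathbb Z}(1+n^2)^k\widehat f(n)\overline{\widehat g(n)}$. Let $S(t)f(e^{ix})=\sum_{n}\widehat f(n)e^{-|n|t}e^{inx}$ (the semigroup generated by $-|D|$, $|D|f=\sum_n|n|\widehat f(n)e^{inx}$). The $L^2$ control system (half-heat equation) is $(\partial_t+|D|)f=\mathbf 1_\omega u$, $f(0,\cdot)=f_0\in L^2(\mathbb T)$, with control $u\in L^2([0,T]\times\omega)$; its solution satisfies $f(T,\cdot)=S(T)f_0+\int_0^TS(T-s)(\mathbf 1_\omega u(s,\cdot))\,ds$, where $\mathbf 1_\omega u$ is the extension of $u$ by $0$ outside $\omega$. $\mathcal{NC}_{L^2}(\omega,T)$ is the set of $f_0\in L^2(\mathbb T)$ for which there is $u\in L^2([0,T]\times\omega)$ with $f(T,\cdot)=0$. (This set does not depend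 on $T>0$.) *)

theory Defs
  imports "HOL-Analysis.Analysis"
begin

text \<open>
  Arc length on the complex unit circle (total mass \<open>2 * pi\<close>); its space is \<open>sphere 0 1\<close>.
\<close>
definition circle_measure :: "complex measure" where
  "circle_measure =
     distr (restrict_space lborel {0..<2 * pi}) (restrict_space borel (sphere 0 1)) cis"

definition open_strict_arc :: "complex set \<Rightarrow> bool" where
  "open_strict_arc \<omega> \<longleftrightarrow>
     (\<exists>a b::real. 0 < b - a \<and> b - a < 2 * pi \<and> \<omega> = cis ` {a<..<b})"

text \<open>
  Elements of \<open>L2\<close> are functions, not classes: equality in the space \<open>L\<^sup>2\<close> is equality almost
  everywhere. Every class has a representative that is measurable for the
  (uncompleted) Borel sets used here.
\<close>
definition L2 :: "'a measure \<Rightarrow> ('a \<Rightarrow> complex) set" where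
  "L2 M = {f \<in> borel_measurable M. integrable M (\<lambda>x. (cmod (f x))\<^sup>2)}"

text \<open>The normalisation is the one for which \<open>f = (\<Sum>n. fourier_coeff f n * z powi n)\<close>.\<close>
definition fourier_coeff :: "(complex \<Rightarrow> complex) \<Rightarrow> int \<Rightarrow> complex" where
  "fourier_coeff f n =
     complex_of_real (1 / (2 * pi)) * (LINT z|circle_measure. f z * z powi (- n))"

definition sobolev_inner ::
    "nat \<Rightarrow> (complex \<Rightarrow> complex) \<Rightarrow> (complex \<Rightarrow> complex) \<Rightarrow> complex" where
  "sobolev_inner k f g =
     (\<Sum>\<^sub>\<infinity>n::int. (1 + of_int n ^ 2) ^ k * fourier_coeff f n * cnj (fourier_coeff g n))"

definition sobolev_norm :: "nat \<Rightarrow> (complex \<Rightarrow> complex) \<Rightarrow> real" where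
  "sobolev_norm k f = sqrt (Re (sobolev_inner k f f))"

text \<open>The space \<open>W\<^sup>k\<^sup>,\<^sup>2\<close> of the circle.\<close>
definition sobolev :: "nat \<Rightarrow> (complex \<Rightarrow> complex) set" where
  "sobolev k = {f \<in> L2 circle_measure.
     (\<lambda>n::int. (1 + real_of_int n ^ 2) ^ k * (cmod (fourier_coeff f n))\<^sup>2) summable_on UNIV}"

definition dense_in_sobolev :: "nat \<Rightarrow> (complex \<Rightarrow> complex) set \<Rightarrow> bool" where
  "dense_in_sobolev k A \<longleftrightarrow> A \<subseteq> sobolev k \<and>
     (\<forall>f\<in>sobolev k. \<forall>\<epsilon>>0. \<exists>g\<in>A. sobolev_norm k (\<lambda>z. f z - g z) < \<epsilon>)"

text \<open>
  The semigroup \<open>S(t)\<close> for \<open>t \<ge> 0\<close>. For \<open>t > 0\<close> the series converges absolutely at every point of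
  the circle. For \<open>t = 0\<close> it is the Fourier series of \<open>f\<close>, which converges to \<open>f\<close> in \<open>L\<^sup>2\<close> but
  need not be unconditionally summable at any point; hence the case distinction.
\<close>
definition half_heat_semigroup ::
    "real \<Rightarrow> (complex \<Rightarrow> complex) \<Rightarrow> complex \<Rightarrow> complex" where
  "half_heat_semigroup t f z =
     (if t = 0 then f z
      else \<Sum>\<^sub>\<infinity>n::int. fourier_coeff f n * exp (- (complex_of_real (\<bar>real_of_int n\<bar> * t))) * z powi n)"

text \<open>
  The \<open>L\<^sup>2\<close>-valued integral of Duhamel's formula is computed pointwise in \<open>z\<close>: for a control \<open>u\<close> in
  \<open>L\<^sup>2([0,t] \<times> \<omega>)\<close> the integrand is jointly measurable, and since
  \<open>S(t - s)\<close> is a contraction of \<open>L\<^sup>1\<close> it is integrable on the product. So by Fubini the integral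
  over \<open>s\<close> exists for almost every \<open>z\<close> and represents the Bochner integral in \<open>L\<^sup>2\<close>.
\<close>
definition half_heat_solution ::
    "complex set \<Rightarrow> (complex \<Rightarrow> complex) \<Rightarrow> (real \<times> complex \<Rightarrow> complex) \<Rightarrow> real \<Rightarrow> complex \<Rightarrow> complex"
  where
  "half_heat_solution \<omega> f\<^sub>0 u t z = half_heat_semigroup t f\<^sub>0 z +
     (LINT s:{0..t}|lborel.
        half_heat_semigroup (t - s) (\<lambda>w. if w \<in> \<omega> then u (s, w) else 0) z)"

definition null_controllable_L2 :: "complex set \<Rightarrow> real \<Rightarrow> (complex \<Rightarrow> complex) set" where
  "null_controllable_L2 \<omega> T = {f\<^sub>0 \<in> L2 circle_measure.
     \<exists>u \<in> L2 (restrict_space lborel {0..T} \<Otimes>\<^sub>M restrict_space circle_measure \<omega>).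
       AE z in circle_measure. half_heat_solution \<omega> f\<^sub>0 u T z = 0}"

end

theory Submission
  imports Defs
begin

text \<open>
  If \<open>w\<close> is a smooth function of time and angle, supported in \<open>\<omega>\<close> and vanishing near time \<open>T\<close>, then
  \<open>f = (\<partial>\<^sub>t - |D|) w\<close> solves the half-heat equation with the control \<open>\<partial>\<^sub>t\<^sup>2 w + \<partial>\<^sub>y\<^sup>2 w\<close>. Hence every
  \<open>w\<^sub>1 - |D| w\<^sub>0\<close> with \<open>w\<^sub>0\<close>, \<open>w\<^sub>1\<close> smooth and supported in \<open>\<omega>\<close> is null controllable. Taking
  \<open>w\<^sub>1 = - i \<partial>\<^sub>y w / 2\<close> and \<open>w\<^sub>0 = - w / 2\<close> leaves only the positive frequencies of \<open>- i \<partial>\<^sub>y w\<close>, and the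
  negative ones are obtained by conjugation. It remains to find functions
  supported in an arc whose Fourier coefficients of index \<open>n \<ge> 0\<close> are uniformly close to those of a
  given \<open>z ^ m\<close>; convolving them with a fixed bump turns this into closeness in all Sobolev norms.
  Such functions are the jumps across the arc of functions holomorphic off the arc that are close
  to \<open>z ^ m\<close> in the disc and vanish at infinity; they are polynomials in the Cauchy integral of a
  nonnegative bump on the arc, whose real part is bounded below in the disc.
\<close>

section \<open>Fourier coefficients on the circle\<close>

text \<open>Two obstacles shape the construction. First, \<open>|D|\<close> is nonlocal, so
  trajectories do not stay supported in \<omega>; the control is local all the same, because the
  product of the two first-order factors contains only the square of \<open>|D|\<close>, which is
  minus the second angular derivative. Second, a function supported in a proper arc cannot have all
  its Fourier coefficients arbitrarily close to those of \<open>z ^ m\<close>, uniformly in the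
  index: pairing with a smooth function supported off the arc would detect it. Half of the spectrum
  has to stay free. This is harmless because the combination carries the multiplier
  \<open>n + |n|\<close>, which vanishes exactly on that half. It also kills \<open>n = 0\<close>,
  so constants are recovered separately, by removing from one controllable datum of nonzero mean all
  its other frequencies. Uniform closeness of coefficients is what a sup norm bound yields;
  convolution multiplies the error by a fixed sequence of finite weighted norm. For a given
  \<open>k\<close> bumps of finite smoothness do this, and in time polynomials take the place of
  smooth cut-offs.\<close>

lemma space_circle_measure [simp]: "space circle_measure = sphere 0 1"
  by (simp add: circle_measure_def space_restrict_space)

lemma sets_circle_measure [measurable_cong]:
  "sets circle_measure = sets (restrict_space borel (sphere 0 1))"
  by (simp add: circle_measure_def)

lemma cis_measurable_circle [measurable]:
  "cis \<in> measurable (restrict_space lborel A) (restrict_space borel (sphere 0 1))"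
proof -
  have "cis \<in> borel_measurable borel"
    by (intro borel_measurable_continuous_onI continuous_intros)
  then have "cis \<in> borel_measurable lborel" by simp
  then have "cis \<in> borel_measurable (restrict_space lborel A)"
    by (rule measurable_restrict_space1)
  then show ?thesis
    by (intro measurable_restrict_space2) auto
qed

lemma finite_measure_restrict_lborel:
  fixes a b :: real
  assumes "A \<in> sets borel" "A \<subseteq> {a..b}"
  shows "finite_measure (restrict_space lborel A)"
proof (rule finite_measureI)
  have "emeasure lborel A \<le> emeasure lborel {a..b}"
    using assms(2) by (intro emeasure_mono) auto
  also have "\<dots> < \<infinity>" by (simp add: emeasure_lborel_Icc_eq)
  finally show "emeasure (restrict_space lborel A) (space (restrict_space lborel A)) \<noteq> \<infinity>"
    using assms by (simp add: emeasure_restrict_space space_restrict_space)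
qed

interpretation circle: finite_measure circle_measure
proof -
  interpret finite_measure "restrict_space lborel {0..<2 * pi}"
    by (rule finite_measure_restrict_lborel[of _ 0 "2 * pi"]) auto
  show "finite_measure circle_measure"
    unfolding circle_measure_def by (rule finite_measure_distr) simp
qed

lemma borel_measurable_circleI:
  assumes "continuous_on (sphere 0 1) f"
  shows "f \<in> borel_measurable circle_measure"
  using borel_measurable_continuous_on_restrict[OF assms]
  by (simp cong: measurable_cong_sets add: sets_circle_measure)

lemma continuous_on_circle_powi [continuous_intros]:
  "continuous_on (sphere 0 1) (\<lambda>z::complex. z powi n)"
  by (intro continuous_intros) auto

lemma powi_measurable_circle [measurable]:
  "(\<lambda>z. z powi n) \<in> borel_measurable circle_measure"
  by (intro borel_measurable_circleI continuous_intros)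

lemma integrable_circle:
  fixes f :: "complex \<Rightarrow> complex"
  assumes "f \<in> borel_measurable circle_measure" "\<And>z. cmod z = 1 \<Longrightarrow> cmod (f z) \<le> B"
  shows "integrable circle_measure f"
  using assms by (intro circle.integrable_const_bound[where B = B] AE_I2) auto

lemma continuous_bounded_circle:
  fixes f :: "complex \<Rightarrow> complex"
  assumes "continuous_on (sphere 0 1) f"
  obtains B where "\<And>z. cmod z = 1 \<Longrightarrow> cmod (f z) \<le> B"
proof -
  have "compact (f ` sphere 0 1)"
    by (intro compact_continuous_image assms compact_sphere)
  then show ?thesis
    using compact_imp_bounded bounded_iff that by (metis imageI mem_sphere_0)
qed

lemma integrable_circle_continuous:
  fixes f :: "complex \<Rightarrow> complex"
  assumes "continuous_on (sphere 0 1) f"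
  shows "integrable circle_measure f"
proof -
  obtain B where "\<And>z. cmod z = 1 \<Longrightarrow> cmod (f z) \<le> B"
    using continuous_bounded_circle[OF assms] by blast
  then show ?thesis
    using borel_measurable_circleI[OF assms] by (intro integrable_circle)
qed

lemma cmod_powi_circle: "cmod z = 1 \<Longrightarrow> cmod (z powi n) = 1"
  by (simp add: norm_power_int)

lemma inverse_circle: "cmod z = 1 \<Longrightarrow> inverse z = cnj z"
proof (rule inverse_unique)
  assume "cmod z = 1"
  then show "z * cnj z = 1"
    unfolding complex_norm_square[symmetric] by (simp only: one_power2 of_real_1)
qed

lemma cnj_powi_circle: "cmod z = 1 \<Longrightarrow> cnj (z powi n) = z powi (- n)"
  using inverse_circle[OF cmod_powi_circle, of z n] power_int_minus[of z n] by argo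

text \<open>The half-open parameter interval is closed up at the cost of a null set, because the
  fundamental theorem of calculus is applied on closed intervals.\<close>

lemma circle_integral_eq:
  fixes f :: "complex \<Rightarrow> complex"
  assumes "f \<in> borel_measurable circle_measure"
  shows "(LINT z|circle_measure. f z) = (LINT y|lborel. indicator {0..2 * pi} y *\<^sub>R f (cis y))"
proof -
  have f: "f \<in> borel_measurable (restrict_space borel (sphere 0 1))"
    using assms by (simp cong: measurable_cong_sets add: sets_circle_measure)
  have "(LINT z|circle_measure. f z) = (LINT y|restrict_space lborel {0..<2 * pi}. f (cis y))"
    unfolding circle_measure_def by (rule integral_distr) (use f in measurable)
  also have "\<dots> = (LINT y|lborel. indicator {0..<2 * pi} y *\<^sub>R f (cis y))"
    by (rule integral_restrict_space) simp
  also have "\<dots> = (LINT y|lborel. indicator {0..2 * pi} y *\<^sub>R f (cis y))"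
  proof (rule integral_cong_AE)
    have [measurable]: "(\<lambda>y. f (cis y)) \<in> borel_measurable borel"
      using measurable_compose[OF cis_measurable_circle[of UNIV] f]
      by (simp cong: measurable_cong_sets add: sets_restrict_space)
    show "(\<lambda>y. indicator {0..<2 * pi} y *\<^sub>R f (cis y)) \<in> borel_measurable lborel"
      "(\<lambda>y. indicator {0..2 * pi} y *\<^sub>R f (cis y)) \<in> borel_measurable lborel"
      by measurable
    show "AE y in lborel. indicator {0..<2 * pi} y *\<^sub>R f (cis y) =
        indicator {0..2 * pi} y *\<^sub>R f (cis y)"
      using AE_lborel_singleton[of "2 * pi"] by eventually_elim (auto simp: indicator_def)
  qed
  finally show ?thesis .
qed

text \<open>The primitive \<open>F\<close> lives on the circle, so it takes the same value at both
  ends of a full turn. Orthogonality of the powers and integration by parts both reduce to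
  this.\<close>

lemma circle_integral_FTC:
  fixes f F :: "complex \<Rightarrow> complex"
  assumes "continuous_on (sphere 0 1) f"
    and "\<And>y. ((\<lambda>y. F (cis y)) has_vector_derivative f (cis y)) (at y)"
  shows "(LINT z|circle_measure. f z) = 0"
proof -
  have "(LINT z|circle_measure. f z) = (LINT y|lborel. indicator {0..2 * pi} y *\<^sub>R f (cis y))"
    by (rule circle_integral_eq[OF borel_measurable_circleI[OF assms(1)]])
  also have "\<dots> = F (cis (2 * pi)) - F (cis 0)"
  proof (rule integral_FTC_atLeastAtMost)
    show "continuous_on {0..2 * pi} (\<lambda>y. f (cis y))"
      by (intro continuous_on_compose2[OF assms(1)] continuous_intros) auto
  qed (use assms(2) in \<open>auto intro: has_vector_derivative_at_within\<close>)
  finally show ?thesis by simp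
qed

lemma cis_powi: "cis y powi n = cis (of_int n * y)"
proof (cases "n \<ge> 0")
  case False
  then have "cis y powi n = inverse (cis y) ^ nat (- n)" by (simp add: power_int_def)
  also have "\<dots> = cis (real (nat (- n)) * (- y))" by (simp only: cis_inverse Complex.DeMoivre)
  finally show ?thesis using False by simp
next
  case True
  then have "cis y powi n = cis (real (nat n) * y)"
    unfolding power_int_def by (simp only: Complex.DeMoivre if_True)
  with True show ?thesis by simp
qed

lemma circle_integral_const: "(LINT z|circle_measure. c) = 2 * of_real pi * (c::complex)"
  by (subst circle_integral_eq) (auto simp: scaleR_conv_of_real)

lemma measure_circle [simp]: "measure circle_measure (sphere 0 1) = 2 * pi"
proof -
  have "complex_of_real (measure circle_measure (sphere 0 1)) = of_real (2 * pi)"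
    using circle_integral_const[of 1] by (simp add: scaleR_conv_of_real)
  then show ?thesis by (simp only: of_real_eq_iff)
qed

lemma has_vector_derivative_cis_powi:
  "((\<lambda>y. cis y powi n) has_vector_derivative \<i> * of_int n * cis y powi n) (at y within A)"
proof -
  have "((\<lambda>y. cis (of_int n * y)) has_vector_derivative (of_int n *\<^sub>R (\<i> * cis (of_int n * y))))
      (at y within A)"
    unfolding cis_conv_exp
    by (auto intro!: derivative_eq_intros has_vector_derivative_real_field
        simp: scaleR_conv_of_real algebra_simps exp_of_real)
  then show ?thesis by (simp add: cis_powi scaleR_conv_of_real algebra_simps)
qed

lemma circle_integral_powi:
  "(LINT z|circle_measure. z powi n) = (if n = 0 then 2 * of_real pi else 0)"
proof (cases "n = 0")
  case False
  have "(LINT z|circle_measure. z powi n) = 0"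
  proof (rule circle_integral_FTC)
    show "((\<lambda>y. cis y powi n / (\<i> * of_int n)) has_vector_derivative cis y powi n) (at y)" for y
      using has_vector_derivative_divide[OF has_vector_derivative_cis_powi[of n y UNIV],
        of "\<i> * of_int n"] False by simp
  qed (intro continuous_intros)
  with False show ?thesis by simp
next
  case True
  then show ?thesis by (simp only: power_int_0_right circle_integral_const if_True) simp
qed

section \<open>Algebra of Fourier coefficients\<close>

lemma fourier_coeff_cong:
  assumes "\<And>z. cmod z = 1 \<Longrightarrow> f z = g z"
  shows "fourier_coeff f n = fourier_coeff g n"
proof -
  have "(LINT z|circle_measure. f z * z powi (- n)) = (LINT z|circle_measure. g z * z powi (- n))"
    by (rule Bochner_Integration.integral_cong) (use assms in auto)
  then show ?thesis by (simp only: fourier_coeff_def)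
qed

lemma integrable_powi_mult:
  assumes "integrable circle_measure f"
  shows "integrable circle_measure (\<lambda>z. f z * z powi n)"
proof (rule Bochner_Integration.integrable_bound[OF assms])
  show "(\<lambda>z. f z * z powi n) \<in> borel_measurable circle_measure"
    using assms by measurable
qed (auto intro!: AE_I2 simp: norm_mult cmod_powi_circle)

lemma fourier_coeff_add:
  assumes "integrable circle_measure f" "integrable circle_measure g"
  shows "fourier_coeff (\<lambda>z. f z + g z) n = fourier_coeff f n + fourier_coeff g n"
  using assms by (simp add: fourier_coeff_def ring_distribs integrable_powi_mult)

lemma fourier_coeff_diff:
  assumes "integrable circle_measure f" "integrable circle_measure g"
  shows "fourier_coeff (\<lambda>z. f z - g z) n = fourier_coeff f n - fourier_coeff g n"
  using assms by (simp add: fourier_coeff_def ring_distribs integrable_powi_mult)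

lemma fourier_coeff_cmult: "fourier_coeff (\<lambda>z. c * f z) n = c * fourier_coeff f n"
  by (simp add: fourier_coeff_def mult.assoc)

lemma fourier_coeff_cnj: "fourier_coeff (\<lambda>z. cnj (f z)) n = cnj (fourier_coeff f (- n))"
proof -
  have "(LINT z|circle_measure. cnj (f z) * z powi (- n)) =
      (LINT z|circle_measure. cnj (f z * z powi n))"
    by (intro Bochner_Integration.integral_cong)
      (simp_all only: complex_cnj_mult cnj_powi_circle space_circle_measure mem_sphere_0)
  also have "\<dots> = cnj (LINT z|circle_measure. f z * z powi n)"
    by (rule Bochner_Integration.integral_cnj)
  finally show ?thesis by (simp only: fourier_coeff_def complex_cnj_mult complex_cnj_complex_of_real
        minus_minus)
qed

lemma fourier_coeff_powi_mult:
  "fourier_coeff (\<lambda>z. z powi m * f z) n = fourier_coeff f (n - m)"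
proof -
  have "z powi m * f z * z powi (- n) = f z * z powi (- (n - m))" if "cmod z = 1" for z
  proof -
    have "z \<noteq> 0" using that by auto
    then show ?thesis by (simp add: power_int_add[symmetric] mult.commute mult.left_commute)
  qed
  then have "(LINT z|circle_measure. z powi m * f z * z powi (- n)) =
      (LINT z|circle_measure. f z * z powi (- (n - m)))"
    by (intro Bochner_Integration.integral_cong refl) (simp only: space_circle_measure mem_sphere_0)
  then show ?thesis by (simp only: fourier_coeff_def)
qed

lemma fourier_coeff_powi: "fourier_coeff (\<lambda>z. z powi m) n = (if n = m then 1 else 0)"
  using fourier_coeff_powi_mult[of m "\<lambda>_. 1" n]
  by (simp add: fourier_coeff_def circle_integral_powi)

lemma cmod_fourier_coeff_le:
  assumes "f \<in> borel_measurable circle_measure" "\<And>z. cmod z = 1 \<Longrightarrow> cmod (f z) \<le> B"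
  shows "cmod (fourier_coeff f n) \<le> B"
proof -
  have "cmod (LINT z|circle_measure. f z * z powi (- n)) \<le> (LINT z|circle_measure. B)"
  proof (rule Bochner_Integration.integral_norm_bound_integral)
    show "integrable circle_measure (\<lambda>z. f z * z powi (- n))"
      using assms by (intro integrable_powi_mult integrable_circle)
  qed (use assms in \<open>auto simp: norm_mult cmod_powi_circle\<close>)
  also have "\<dots> = 2 * pi * B"
    by simp
  finally show ?thesis
    by (simp add: fourier_coeff_def norm_mult norm_divide field_simps)
qed

lemma fourier_coeff_derivative:
  assumes "continuous_on (sphere 0 1) f" "continuous_on (sphere 0 1) f'"
    and "\<And>y. ((\<lambda>y. f (cis y)) has_vector_derivative f' (cis y)) (at y)"
  shows "fourier_coeff f' n = \<i> * of_int n * fourier_coeff f n"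
proof -
  \<comment> \<open>Integration by parts: \<open>?g\<close> is the angular derivative of
    \<open>f z * z powi (- n)\<close>.\<close>
  let ?g = "\<lambda>z. f' z * z powi (- n) - \<i> * of_int n * (f z * z powi (- n))"
  have "(LINT z|circle_measure. ?g z) = 0"
  proof (rule circle_integral_FTC)
    show "continuous_on (sphere 0 1) ?g"
      by (intro continuous_on_diff continuous_on_mult continuous_on_const continuous_on_circle_powi
          assms(1,2))
    show "((\<lambda>y. f (cis y) * cis y powi (- n)) has_vector_derivative ?g (cis y)) (at y)" for y
      using has_vector_derivative_mult[OF assms(3) has_vector_derivative_cis_powi[of "- n"]]
      by (simp add: algebra_simps)
  qed
  moreover have "(LINT z|circle_measure. ?g z) = (LINT z|circle_measure. f' z * z powi (- n)) -
      \<i> * of_int n * (LINT z|circle_measure. f z * z powi (- n))"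
    by (simp only: Bochner_Integration.integral_diff integrable_mult_right integrable_powi_mult
        integrable_circle_continuous assms(1,2) integral_mult_right_zero)
  ultimately show ?thesis by (simp add: fourier_coeff_def)
qed

text \<open>As a function of the rotation angle the integral is \<open>J (2 * pi + s) - J s\<close>
  with \<open>J\<close> a primitive of \<open>h\<close>. Its derivative vanishes by periodicity, so
  it keeps its value at angle 0.\<close>

lemma circle_integral_rotate:
  fixes f :: "complex \<Rightarrow> complex"
  assumes f: "continuous_on (sphere 0 1) f" and w: "cmod w = 1"
  shows "(LINT z|circle_measure. f (z * w)) = (LINT z|circle_measure. f z)"
proof -
  obtain t where t: "w = cis t" using w by (metis complex_norm_eq_1_exp cis_conv_exp)
  define h where "h y = f (cis y)" for y
  have h: "continuous_on A h" for A
    unfolding h_def by (intro continuous_on_compose2[OF f] continuous_intros) auto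
  \<comment> \<open>The bounds put \<open>s\<close>, \<open>2 * pi + s\<close> and all points
    between strictly inside \<open>{a..b}\<close> whenever
    \<open>\<bar>s\<bar> \<le> \<bar>t\<bar>\<close>, so that \<open>J\<close> has a two-sided
    derivative there.\<close>
  define a where "a = - 2 * pi - \<bar>t\<bar>"
  define b where "b = 2 * (2 * pi + \<bar>t\<bar>)"
  define J where "J x = integral {a..x} h" for x
  have J: "(J has_vector_derivative h x) (at x)" if "a < x" "x < b" for x
    using integral_has_vector_derivative[OF h, of x a b] that unfolding J_def
    by (simp add: at_within_Icc_at)
  have eq: "(LINT z|circle_measure. f (z * cis s)) = J (2 * pi + s) - J s" if "\<bar>s\<bar> \<le> \<bar>t\<bar>" for s
  proof -
    have "(LINT z|circle_measure. f (z * cis s)) =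
      (LINT y|lborel. indicator {0..2 * pi} y *\<^sub>R h (y + s))"
      unfolding h_def cis_mult[symmetric]
      by (intro circle_integral_eq borel_measurable_circleI continuous_on_compose2[OF f] continuous_intros)
       (auto simp: norm_mult)
    also have "\<dots> = J (2 * pi + s) - J (0 + s)"
    proof (rule integral_FTC_atLeastAtMost)
      fix x assume "0 \<le> x" "x \<le> 2 * pi"
      then have "a < x + s" "x + s < b" using that pi_gt_zero unfolding a_def b_def by (smt (verit))+
      have "((\<lambda>x. x + s) has_vector_derivative 1) (at x)"
        by (auto intro!: derivative_eq_intros)
      from vector_diff_chain_at[OF this J] \<open>a < x + s\<close> \<open>x + s < b\<close>
      show "((\<lambda>x. J (x + s)) has_vector_derivative h (x + s)) (at x within {0..2 * pi})"
        by (auto intro!: has_vector_derivative_at_within simp: o_def)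
    qed (auto intro!: continuous_on_compose2[OF h] continuous_intros)
    finally show ?thesis by simp
  qed
  define D where "D s = J (2 * pi + s) - J s" for s
  have "(D has_vector_derivative 0) (at x within {-\<bar>t\<bar>..\<bar>t\<bar>})" if "x \<in> {-\<bar>t\<bar>..\<bar>t\<bar>}" for x
  proof -
    note x = that
    have b1: "a < 2 * pi + x" "2 * pi + x < b" "a < x" "x < b"
      using x pi_gt_zero unfolding a_def b_def atLeastAtMost_iff by (smt (verit))+
    have "((\<lambda>x. 2 * pi + x) has_vector_derivative 1) (at x)"
      by (auto intro!: derivative_eq_intros)
    from vector_diff_chain_at[OF this J] b1
    have "((\<lambda>x. J (2 * pi + x)) has_vector_derivative h (2 * pi + x)) (at x)"
      by (simp add: o_def)
    from has_vector_derivative_diff[OF this J[OF b1(3,4)]]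
    show "(D has_vector_derivative 0) (at x within {-\<bar>t\<bar>..\<bar>t\<bar>})"
      unfolding D_def
      by (auto intro!: has_vector_derivative_at_within simp: h_def cis_mult[symmetric])
  qed
  then obtain c where "\<And>x. x \<in> {-\<bar>t\<bar>..\<bar>t\<bar>} \<Longrightarrow> D x = c"
    using has_vector_derivative_zero_constant[of "{-\<bar>t\<bar>..\<bar>t\<bar>}" D] by auto
  then have "D t = D 0" by (metis abs_ge_minus_self abs_ge_self abs_le_iff abs_ge_zero
        atLeastAtMost_iff neg_le_0_iff_le minus_le_iff)
  then show ?thesis using eq[of t] eq[of 0] by (simp add: D_def t)
qed

lemma circle_integral_rotate_powi:
  fixes f :: "complex \<Rightarrow> complex"
  assumes f: "continuous_on (sphere 0 1) f" and w: "cmod w = 1"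
  shows "(LINT z|circle_measure. f (z * cnj w) * z powi (- n)) =
     w powi (- n) * (LINT z|circle_measure. f z * z powi (- n))"
proof -
  have w0: "w \<noteq> 0" using w by auto
  have cw: "cnj w = inverse w" using inverse_circle[OF w] by simp
  have "(LINT z|circle_measure. f (z * cnj w) * z powi (- n)) =
      (LINT z|circle_measure. w powi (- n) * (f (z * cnj w) * (z * cnj w) powi (- n)))"
    by (intro Bochner_Integration.integral_cong refl)
      (simp add: cw power_int_mult_distrib power_int_inverse power_int_minus w0)
  also have "\<dots> = w powi (- n) * (LINT z|circle_measure. f (z * cnj w) * (z * cnj w) powi (- n))"
    by simp
  also have "(LINT z|circle_measure. f (z * cnj w) * (z * cnj w) powi (- n)) =
      (LINT z|circle_measure. f z * z powi (- n))"
    by (rule circle_integral_rotate[where f = "\<lambda>z. f z * z powi (- n)"])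
      (auto intro!: continuous_on_mult f continuous_on_circle_powi simp: w)
  finally show ?thesis .
qed

lemma fourier_coeff_rotate:
  assumes "continuous_on (sphere 0 1) f" "cmod w = 1"
  shows "fourier_coeff (\<lambda>z. f (z * cnj w)) n = w powi (- n) * fourier_coeff f n"
  by (simp only: fourier_coeff_def circle_integral_rotate_powi[OF assms] mult.left_commute)

section \<open>Absolutely convergent series over the integers\<close>

lemma infsum_int_eq_suminf:
  fixes g :: "int \<Rightarrow> 'a::banach"
  assumes "\<And>n. norm (g n) \<le> B n" "B summable_on UNIV"
  shows "infsum g UNIV = (\<Sum>j. g (int_decode j))"
    and "summable (\<lambda>j. norm (g (int_decode j)))"
proof -
  have bij: "bij_betw int_decode UNIV UNIV" by (rule bij_int_decode)
  have *: "(\<lambda>n. norm (g n)) summable_on UNIV"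
    by (rule summable_on_comparison_test[OF assms(2)]) (use assms in auto)
  then have "((\<lambda>j. norm (g (int_decode j))) has_sum infsum (\<lambda>n. norm (g n)) UNIV) UNIV"
    by (subst has_sum_reindex_bij_betw[OF bij]) (rule has_sum_infsum)
  then show "summable (\<lambda>j. norm (g (int_decode j)))"
    using has_sum_imp_sums sums_summable by blast
  have "g summable_on UNIV"
    using * by (rule abs_summable_summable)
  then have "((\<lambda>j. g (int_decode j)) has_sum infsum g UNIV) UNIV"
    by (subst has_sum_reindex_bij_betw[OF bij]) (rule has_sum_infsum)
  then show "infsum g UNIV = (\<Sum>j. g (int_decode j))"
    using has_sum_imp_sums sums_unique by blast
qed

text \<open>The bound is uniform in \<open>x\<close>, so on a finite measure space the integrals of
  the norms are summable; \<open>int_decode\<close> then reduces the claim to termwise integration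
  of a series over the naturals.\<close>

lemma (in finite_measure) integral_infsum_int:
  fixes f :: "int \<Rightarrow> 'a \<Rightarrow> 'b::{banach, second_countable_topology}"
  assumes [measurable]: "\<And>n. f n \<in> borel_measurable M"
    and B: "\<And>n x. x \<in> space M \<Longrightarrow> norm (f n x) \<le> B n" "B summable_on UNIV"
  shows "(LINT x|M. (\<Sum>\<^sub>\<infinity>n. f n x)) = (\<Sum>\<^sub>\<infinity>n. (LINT x|M. f n x))"
    and "integrable M (\<lambda>x. \<Sum>\<^sub>\<infinity>n. f n x)"
proof -
  have int: "integrable M (f n)" for n
    using B by (intro integrable_const_bound[where B = "B n"] AE_I2) auto
  have eq: "(\<Sum>\<^sub>\<infinity>n. f n x) = (\<Sum>j. f (int_decode j) x)"
      "summable (\<lambda>j. norm (f (int_decode j) x))" if "x \<in> space M" for x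
    using infsum_int_eq_suminf[OF B(1)[OF that] B(2)] by auto
  have nb: "(LINT x|M. norm (f n x)) \<le> measure M (space M) * B n" for n
  proof -
    have "(LINT x|M. norm (f n x)) \<le> (LINT x|M. B n)"
      by (intro integral_mono integrable_norm int) (auto simp: B)
    then show ?thesis by simp
  qed
  have sB: "(\<lambda>n. measure M (space M) * B n) summable_on UNIV"
    using B(2) by (rule summable_on_cmult_right)
  have 1: "summable (\<lambda>j. LINT x|M. norm (f (int_decode j) x))"
    using infsum_int_eq_suminf(2)[of "\<lambda>n. LINT x|M. norm (f n x)", OF _ sB] nb by simp
  have 2: "AE x in M. summable (\<lambda>j. norm (f (int_decode j) x))"
    using eq by (intro AE_I2) auto
  have "integrable M (\<lambda>x. \<Sum>j. f (int_decode j) x)"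
    by (rule integrable_suminf[OF int 2 1])
  then show "integrable M (\<lambda>x. \<Sum>\<^sub>\<infinity>n. f n x)"
    by (subst Bochner_Integration.integrable_cong[OF refl eq(1)]) auto
  have "(LINT x|M. (\<Sum>\<^sub>\<infinity>n. f n x)) = (LINT x|M. (\<Sum>j. f (int_decode j) x))"
    by (intro Bochner_Integration.integral_cong eq refl)
  also have "\<dots> = (\<Sum>j. (LINT x|M. f (int_decode j) x))"
    by (rule integral_suminf[OF int 2 1])
  also have "\<dots> = (\<Sum>\<^sub>\<infinity>n. (LINT x|M. f n x))"
  proof (rule infsum_int_eq_suminf(1)[symmetric, OF _ sB])
    show "norm (LINT x|M. f n x) \<le> measure M (space M) * B n" for n
      using nb integral_norm_bound[of M "f n"] order_trans by blast
  qed
  finally show "(LINT x|M. (\<Sum>\<^sub>\<infinity>n. f n x)) = (\<Sum>\<^sub>\<infinity>n. (LINT x|M. f n x))" .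
qed

definition fourier_series :: "(int \<Rightarrow> complex) \<Rightarrow> complex \<Rightarrow> complex" where
  "fourier_series a z = (\<Sum>\<^sub>\<infinity>n. a n * z powi n)"

lemma continuous_on_fourier_series:
  assumes "(\<lambda>n. cmod (a n)) summable_on UNIV"
  shows "continuous_on (sphere 0 1) (fourier_series a)"
proof -
  have "uniform_limit (sphere 0 1) (\<lambda>X z. \<Sum>n\<in>X. a n * z powi n) (fourier_series a)
      (finite_subsets_at_top UNIV)"
    unfolding fourier_series_def
    by (rule Weierstrass_m_test_general[OF _ assms]) (auto simp: norm_mult cmod_powi_circle)
  then show ?thesis
    by (rule uniform_limit_theorem[rotated])
      (auto intro!: always_eventually continuous_intros)
qed

text \<open>Multiplication by a series convolves the coefficients; boundedness of \<open>h\<close>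
  supplies the majorant for integrating term by term.\<close>

lemma fourier_coeff_fourier_series_mult:
  assumes a: "(\<lambda>n. cmod (a n)) summable_on UNIV"
    and h: "continuous_on (sphere 0 1) h"
  shows "fourier_coeff (\<lambda>z. h z * fourier_series a z) m = (\<Sum>\<^sub>\<infinity>n. a n * fourier_coeff h (m - n))"
proof -
  obtain B where B: "\<And>z. cmod z = 1 \<Longrightarrow> cmod (h z) \<le> B"
    using continuous_bounded_circle[OF h] by blast
  have [measurable]: "h \<in> borel_measurable circle_measure"
    by (rule borel_measurable_circleI[OF h])
  have eq: "h z * fourier_series a z * z powi (- m) =
      (\<Sum>\<^sub>\<infinity>n. a n * (h z * z powi (- (m - n))))" if "cmod z = 1" for z
  proof -
    have "z \<noteq> 0" using that by auto
    have "h z * fourier_series a z * z powi (- m) = (h z * z powi (- m)) * fourier_series a z"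
      by simp
    also have "\<dots> = (\<Sum>\<^sub>\<infinity>n. (h z * z powi (- m)) * (a n * z powi n))"
      unfolding fourier_series_def by (rule infsum_cmult_right'[symmetric])
    also have "\<dots> = (\<Sum>\<^sub>\<infinity>n. a n * (h z * z powi (- (m - n))))"
      using \<open>z \<noteq> 0\<close> by (intro infsum_cong) (simp add: power_int_add[symmetric] algebra_simps)
    finally show ?thesis .
  qed
  have "(LINT z|circle_measure. h z * fourier_series a z * z powi (- m)) =
      (LINT z|circle_measure. (\<Sum>\<^sub>\<infinity>n. a n * (h z * z powi (- (m - n)))))"
    by (intro Bochner_Integration.integral_cong refl) (simp only: eq space_circle_measure mem_sphere_0)
  also have "\<dots> = (\<Sum>\<^sub>\<infinity>n. (LINT z|circle_measure. a n * (h z * z powi (- (m - n)))))"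
  proof (rule circle.integral_infsum_int)
    show "(\<lambda>n. cmod (a n) * B) summable_on UNIV"
      using a by (rule summable_on_cmult_left)
    show "norm (a n * (h z * z powi (- (m - n)))) \<le> cmod (a n) * B"
      if "z \<in> space circle_measure" for n z
      using that B by (simp add: norm_mult cmod_powi_circle mult_left_mono)
  qed measurable
  also have "\<dots> = (\<Sum>\<^sub>\<infinity>n. a n * (LINT z|circle_measure. h z * z powi (- (m - n))))"
    by simp
  finally show ?thesis
    by (simp only: fourier_coeff_def infsum_cmult_right'[symmetric] mult.left_commute)
qed

lemma infsum_single_int:
  fixes f :: "int \<Rightarrow> complex"
  assumes "\<And>n. n \<noteq> m \<Longrightarrow> f n = 0"
  shows "infsum f UNIV = f m"
proof -
  have "infsum f UNIV = infsum f {m}"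
    by (rule infsum_cong_neutral) (use assms in auto)
  then show ?thesis by simp
qed

lemma fourier_coeff_fourier_series:
  assumes "(\<lambda>n. cmod (a n)) summable_on UNIV"
  shows "fourier_coeff (fourier_series a) m = a m"
proof -
  have "fourier_coeff (\<lambda>z. 1 * fourier_series a z) m =
      (\<Sum>\<^sub>\<infinity>n. a n * fourier_coeff (\<lambda>z. 1) (m - n))"
    by (rule fourier_coeff_fourier_series_mult[OF assms]) auto
  also have "\<dots> = a m"
    by (subst infsum_single_int[of m]) (use fourier_coeff_powi[of 0] in auto)
  finally show ?thesis by simp
qed

text \<open>On the circle \<open>Re z\<close> and \<open>Im z\<close> are combinations of
  \<open>z\<close> and its inverse, and multiplying by either of these merely shifts the
  coefficients. So functions with vanishing coefficients are stable under multiplication by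
  polynomials in the coordinates.\<close>

lemma fourier_coeff_mult_zero:
  assumes p: "polynomial_function p" and f: "continuous_on (sphere 0 1) f"
    and 0: "\<And>n. fourier_coeff f n = 0"
  shows "fourier_coeff (\<lambda>z. f z * p z) n = 0"
proof -
  define Z where "Z = {f. continuous_on (sphere 0 1) f \<and> (\<forall>n. fourier_coeff f n = 0)}"
  have add_Z: "(\<lambda>z. f z + g z) \<in> Z" if "f \<in> Z" "g \<in> Z" for f g
    using that by (auto simp: Z_def fourier_coeff_add integrable_circle_continuous intro: continuous_intros)
  have scale: "(\<lambda>z. f z * c) \<in> Z" if "f \<in> Z" for f c
    using that fourier_coeff_cmult[of c f]
    by (auto simp: Z_def mult.commute[of _ c] intro: continuous_intros)
  have shift: "(\<lambda>z. f z * z powi m) \<in> Z" if "f \<in> Z" for f m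
    using that fourier_coeff_powi_mult[of m f]
    by (auto simp: Z_def mult.commute[of _ "_ powi m"] intro: continuous_intros)
  have cong: "g \<in> Z" if "f \<in> Z" "\<And>z. cmod z = 1 \<Longrightarrow> g z = f z" for f g
    using that fourier_coeff_cong[of f g] continuous_on_cong[of "sphere 0 1" "sphere 0 1" f g]
    by (auto simp: Z_def)
  have real: "\<forall>f\<in>Z. (\<lambda>z. f z * of_real (q z)) \<in> Z" if "real_polynomial_function q" for q
    using that
  proof induction
    case (linear q)
    show ?case
    proof
      fix f assume f: "f \<in> Z"
      define c where "c = complex_of_real (q 1)"
      define d where "d = complex_of_real (q \<i>)"
      \<comment> \<open>A real-linear \<open>q\<close> is \<open>Re z * q 1 + Im z * q \<i>\<close>;
        the two factors come from \<open>Re z = (z + cnj z) / 2\<close> and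
        \<open>Im z = (z - cnj z) / (2 * \<i>)\<close>.\<close>
      have "(\<lambda>z. (f z * z powi 1) * ((c - \<i> * d) / 2) + (f z * z powi (-1)) * ((c + \<i> * d) / 2)) \<in> Z"
        by (intro add_Z scale shift f)
      then show "(\<lambda>z. f z * of_real (q z)) \<in> Z"
      proof (rule cong)
        fix z :: complex assume z: "cmod z = 1"
        have "z = Re z *\<^sub>R 1 + Im z *\<^sub>R \<i>" by (simp add: complex_eq_iff)
        then have "q z = q (Re z *\<^sub>R 1 + Im z *\<^sub>R \<i>)" by simp
        also have "\<dots> = Re z * q 1 + Im z * q \<i>"
          using linear by (simp add: bounded_linear.linear linear_add linear_scale)
        finally have 1: "complex_of_real (q z) = of_real (Re z) * c + of_real (Im z) * d"
          by (simp add: c_def d_def)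
        have "z powi (-1) = cnj z"
          using inverse_circle[OF z] by (simp add: power_int_minus)
        then have "z * ((c - \<i> * d) / 2) + z powi (-1) * ((c + \<i> * d) / 2) =
            ((z + cnj z) / 2) * c + ((z - cnj z) / (2 * \<i>)) * d"
          by (simp add: field_simps)
        also have "(z + cnj z) / 2 = of_real (Re z)" by (simp add: complex_add_cnj)
        also have "(z - cnj z) / (2 * \<i>) = of_real (Im z)" by (simp add: complex_eq_iff)
        finally show "f z * of_real (q z) =
            (f z * z powi 1) * ((c - \<i> * d) / 2) + (f z * z powi (-1)) * ((c + \<i> * d) / 2)"
          by (simp only: 1 mult.assoc distrib_left[symmetric] power_int_1_right)
      qed
    qed
  next
    case (const c)
    then show ?case using scale by auto
  next
    case (add q r)
    show ?case
    proof
      fix f assume "f \<in> Z"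
      then have "(\<lambda>z. f z * of_real (q z) + f z * of_real (r z)) \<in> Z"
        by (intro add_Z add.IH[rule_format])
      then show "(\<lambda>z. f z * of_real (q z + r z)) \<in> Z" by (simp add: distrib_left)
    qed
  next
    case (mult q r)
    show ?case
    proof
      fix f assume "f \<in> Z"
      then have "(\<lambda>z. (f z * of_real (q z)) * of_real (r z)) \<in> Z"
        by (intro mult.IH(2)[rule_format] mult.IH(1)[rule_format])
      then show "(\<lambda>z. f z * of_real (q z * r z)) \<in> Z" by (simp add: mult.assoc)
    qed
  qed
  have f: "f \<in> Z" using f 0 by (simp add: Z_def)
  have "real_polynomial_function (Re \<circ> p)" "real_polynomial_function (Im \<circ> p)"
    using p bounded_linear_Re bounded_linear_Im by (auto simp: polynomial_function_def)
  then have "(\<lambda>z. f z * of_real (Re (p z)) + (f z * of_real (Im (p z))) * \<i>) \<in> Z"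
    using real f by (intro add_Z scale) (auto simp: o_def)
  also have "(\<lambda>z. f z * of_real (Re (p z)) + (f z * of_real (Im (p z))) * \<i>) = (\<lambda>z. f z * p z)"
  proof
    fix z
    have "f z * of_real (Re (p z)) + (f z * of_real (Im (p z))) * \<i> =
        f z * (of_real (Re (p z)) + \<i> * of_real (Im (p z)))" by (simp add: algebra_simps)
    then show "f z * of_real (Re (p z)) + (f z * of_real (Im (p z))) * \<i> = f z * p z"
      by (simp only: complex_eq[symmetric])
  qed
  finally show ?thesis by (simp add: Z_def)
qed

lemma circle_integral_nonneg_eq_0:
  assumes f: "continuous_on (sphere 0 1) f" and nn: "\<And>z. cmod z = 1 \<Longrightarrow> 0 \<le> f z"
    and 0: "(LINT z|circle_measure. complex_of_real (f z)) = 0" and z: "cmod z = 1"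
  shows "f z = (0::real)"
proof -
  have c: "continuous_on {0..2 * pi} (\<lambda>y. f (cis y))"
    by (intro continuous_on_compose2[OF f] continuous_intros) auto
  have "(LINT z|circle_measure. complex_of_real (f z)) =
      (LINT y|lborel. indicator {0..2 * pi} y *\<^sub>R complex_of_real (f (cis y)))"
    by (intro circle_integral_eq borel_measurable_circleI continuous_intros f)
  also have "\<dots> = (LINT y|lborel. complex_of_real (indicator {0..2 * pi} y *\<^sub>R f (cis y)))"
    by (simp add: scaleR_conv_of_real)
  also have "\<dots> = of_real (LINT y:{0..2 * pi}|lborel. f (cis y))"
    unfolding set_lebesgue_integral_def by (rule integral_complex_of_real)
  also have "(LINT y:{0..2 * pi}|lborel. f (cis y)) = integral {0..2 * pi} (\<lambda>y. f (cis y))"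
    by (intro set_borel_integral_eq_integral borel_integrable_atLeastAtMost' c)
  finally have "integral {0..2 * pi} (\<lambda>y. f (cis y)) = 0"
    using 0 by simp
  then have *: "\<forall>y\<in>{0..2 * pi}. f (cis y) = 0"
    by (subst (asm) integral_eq_0_iff[OF c]) (auto simp: nn)
  have "z = cis (Arg2pi z)"
    using Arg2pi_eq[of z] z by (simp add: cis_conv_exp)
  moreover have "Arg2pi z \<in> {0..2 * pi}"
    using Arg2pi_ge_0[of z] Arg2pi_lt_2pi[of z] by simp
  ultimately show ?thesis using * by metis
qed

text \<open>Polynomial multiples of \<open>f\<close> have mean zero, and by Stone-Weierstrass some
  polynomial is uniformly close to \<open>cnj (f z)\<close>. Hence the mean of
  \<open>(cmod (f z))\<^sup>2\<close> is zero.\<close>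

lemma fourier_coeff_eq_0_imp_eq_0:
  assumes f: "continuous_on (sphere 0 1) f" and 0: "\<And>n. fourier_coeff f n = 0"
    and z: "cmod z = 1"
  shows "f z = 0"
proof -
  have int0: "fourier_coeff g 0 = complex_of_real (1 / (2 * pi)) * (LINT z|circle_measure. g z)" for g
    by (simp add: fourier_coeff_def)
  have meas: "f \<in> borel_measurable circle_measure" by (rule borel_measurable_circleI[OF f])
  have "compact (f ` sphere 0 1)"
    by (intro compact_continuous_image f compact_sphere)
  then obtain B where B: "B > 0" "\<And>z. cmod z = 1 \<Longrightarrow> cmod (f z) \<le> B"
    using compact_imp_bounded bounded_pos by (metis imageI mem_sphere_0)
  have "cmod (fourier_coeff (\<lambda>z. f z * cnj (f z)) 0) \<le> e" if "e > 0" for e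
  proof -
    have "\<exists>p. polynomial_function p \<and> (\<forall>x\<in>sphere 0 1. cmod (cnj (f x) - p x) < e / B)"
      using that B(1) by (intro Stone_Weierstrass_polynomial_function continuous_intros f) auto
    then obtain p where p: "polynomial_function p"
        "\<And>x. cmod x = 1 \<Longrightarrow> cmod (cnj (f x) - p x) < e / B" by auto
    have cp: "continuous_on (sphere 0 1) p"
      using p(1) by (rule continuous_on_polymonial_function)
    have "fourier_coeff (\<lambda>z. f z * cnj (f z) - f z * p z) 0 =
       fourier_coeff (\<lambda>z. f z * cnj (f z)) 0 - fourier_coeff (\<lambda>z. f z * p z) 0"
      by (intro fourier_coeff_diff integrable_circle_continuous continuous_intros f cp)
    then have "fourier_coeff (\<lambda>z. f z * cnj (f z)) 0 =
        fourier_coeff (\<lambda>z. f z * cnj (f z) - f z * p z) 0"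
      using fourier_coeff_mult_zero[OF p(1) f 0] by simp
    also have "cmod \<dots> \<le> B * (e / B)"
    proof (rule cmod_fourier_coeff_le)
      show "(\<lambda>z. f z * cnj (f z) - f z * p z) \<in> borel_measurable circle_measure"
        by (intro borel_measurable_circleI continuous_intros f cp)
      show "cmod (f z * cnj (f z) - f z * p z) \<le> B * (e / B)" if "cmod z = 1" for z
        unfolding right_diff_distrib[symmetric] norm_mult
        using B p(2)[OF that] that by (intro mult_mono) (auto intro: less_imp_le)
    qed
    finally show ?thesis using B(1) by simp
  qed
  then have "cmod (fourier_coeff (\<lambda>z. f z * cnj (f z)) 0) \<le> 0"
    by (rule field_le_epsilon[where y = 0, simplified])
  then have "(LINT z|circle_measure. f z * cnj (f z)) = 0" by (simp add: int0)
  moreover have "(\<lambda>z. f z * cnj (f z)) = (\<lambda>z. complex_of_real ((cmod (f z))\<^sup>2))"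
    by (simp only: complex_norm_square)
  ultimately have "(LINT z|circle_measure. complex_of_real ((cmod (f z))\<^sup>2)) = 0" by metis
  then have "(cmod (f z))\<^sup>2 = 0"
    using z by (intro circle_integral_nonneg_eq_0[of "\<lambda>z. (cmod (f z))\<^sup>2"] continuous_intros f) auto
  then show ?thesis by simp
qed

text \<open>The series is continuous and has the coefficients of \<open>f\<close>, so uniqueness
  identifies the two at every point.\<close>

lemma fourier_inversion:
  assumes f: "continuous_on (sphere 0 1) f" and s: "(\<lambda>n. cmod (fourier_coeff f n)) summable_on UNIV"
    and z: "cmod z = 1"
  shows "f z = fourier_series (fourier_coeff f) z"
proof -
  have c: "continuous_on (sphere 0 1) (fourier_series (fourier_coeff f))"
    by (rule continuous_on_fourier_series[OF s])
  have "f z - fourier_series (fourier_coeff f) z = 0"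
    by (intro fourier_coeff_eq_0_imp_eq_0[of "\<lambda>z. f z - fourier_series (fourier_coeff f) z"]
         continuous_intros f c z)
      (simp add: fourier_coeff_diff integrable_circle_continuous f c fourier_coeff_fourier_series s)
  then show ?thesis by simp
qed

section \<open>Convolution with bumps\<close>

text \<open>On the circle \<open>cnj w\<close> is the inverse of \<open>w\<close>; unlike the
  inverse it keeps the argument of \<kappa> continuous on the whole plane.\<close>

definition circle_conv :: "(complex \<Rightarrow> complex) \<Rightarrow> (complex \<Rightarrow> complex) \<Rightarrow> complex \<Rightarrow> complex" where
  "circle_conv \<Phi> \<kappa> z = complex_of_real (1 / (2 * pi)) * (LINT w|circle_measure. \<Phi> w * \<kappa> (z * cnj w))"

lemma circle_conv_measurable_integrand:
  fixes \<Phi> \<kappa> :: "complex \<Rightarrow> complex"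
  assumes "\<Phi> \<in> borel_measurable circle_measure" and \<kappa>: "continuous_on UNIV \<kappa>"
  shows "(\<lambda>x. \<Phi> (snd x) * \<kappa> (fst x * cnj (snd x))) \<in> borel_measurable (circle_measure \<Otimes>\<^sub>M circle_measure)"
proof -
  have id: "(\<lambda>z. z) \<in> borel_measurable circle_measure" "cnj \<in> borel_measurable circle_measure"
    by (intro borel_measurable_circleI continuous_intros)+
  have k: "\<kappa> \<in> borel_measurable borel"
    using \<kappa> by (rule borel_measurable_continuous_onI)
  have "(\<lambda>x. fst x * cnj (snd x)) \<in> borel_measurable (circle_measure \<Otimes>\<^sub>M circle_measure)"
    by (intro borel_measurable_times measurable_compose[OF measurable_fst id(1)]
        measurable_compose[OF measurable_snd id(2)])
  from measurable_compose[OF this k] show ?thesis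
    by (intro borel_measurable_times measurable_compose[OF measurable_snd assms(1)])
qed

lemma circle_conv_measurable:
  assumes "\<Phi> \<in> borel_measurable circle_measure" "continuous_on UNIV \<kappa>"
  shows "circle_conv \<Phi> \<kappa> \<in> borel_measurable circle_measure"
proof -
  have "(\<lambda>z. LINT w|circle_measure. \<Phi> w * \<kappa> (z * cnj w)) \<in> borel_measurable circle_measure"
    using circle_conv_measurable_integrand[OF assms]
    by (intro circle.borel_measurable_lebesgue_integral) (simp add: case_prod_beta')
  then show ?thesis unfolding circle_conv_def by measurable
qed

text \<open>Fubini and rotation invariance in \<open>z\<close> split the double integral into a
  product; the factor \<open>1 / (2 * pi)\<close> in the convolution makes the constants
  match.\<close>

lemma fourier_coeff_circle_conv:
  assumes \<Phi>: "\<Phi> \<in> borel_measurable circle_measure" "\<And>z. cmod z = 1 \<Longrightarrow> cmod (\<Phi> z) \<le> A"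
    and \<kappa>: "continuous_on UNIV \<kappa>"
  shows "fourier_coeff (circle_conv \<Phi> \<kappa>) n = fourier_coeff \<Phi> n * fourier_coeff \<kappa> n"
proof -
  interpret P: pair_sigma_finite circle_measure circle_measure ..
  interpret Q: finite_measure "circle_measure \<Otimes>\<^sub>M circle_measure"
    by (intro finite_measure_pair_measure circle.finite_measure_axioms)
  have k: "continuous_on (sphere 0 1) \<kappa>" using \<kappa> by (rule continuous_on_subset) auto
  obtain B where B: "\<And>z. cmod z = 1 \<Longrightarrow> cmod (\<kappa> z) \<le> B"
    using continuous_bounded_circle[OF k] by blast
  let ?I = "\<lambda>w z. \<Phi> w * \<kappa> (z * cnj w) * z powi (- n)"
  have int: "integrable (circle_measure \<Otimes>\<^sub>M circle_measure) (\<lambda>(z, w). ?I w z)"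
  proof (rule Q.integrable_const_bound[where B = "A * B"])
    show "(\<lambda>(z, w). ?I w z) \<in> borel_measurable (circle_measure \<Otimes>\<^sub>M circle_measure)"
      unfolding case_prod_beta'
      by (intro borel_measurable_times circle_conv_measurable_integrand \<Phi> \<kappa>
          measurable_compose[OF measurable_fst powi_measurable_circle])
    show "AE x in circle_measure \<Otimes>\<^sub>M circle_measure. norm (case x of (z, w) \<Rightarrow> ?I w z) \<le> A * B"
    proof (rule AE_I2)
      fix x assume "x \<in> space (circle_measure \<Otimes>\<^sub>M circle_measure)"
      then obtain z w where x: "x = (z, w)" "cmod z = 1" "cmod w = 1"
        by (auto simp: space_pair_measure)
      have "cmod (\<Phi> w) * cmod (\<kappa> (z * cnj w)) \<le> A * B"
        using x \<Phi>(2)[OF x(3)] by (intro mult_mono B) (auto simp: norm_mult intro: order_trans[OF norm_ge_zero])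
      then show "norm (case x of (z, w) \<Rightarrow> ?I w z) \<le> A * B"
        using x by (simp add: norm_mult cmod_powi_circle)
    qed
  qed
  have inner: "(LINT z|circle_measure. ?I w z) =
      \<Phi> w * w powi (- n) * (LINT z|circle_measure. \<kappa> z * z powi (- n))" if w: "cmod w = 1" for w
    using circle_integral_rotate_powi[OF k w] by (simp add: mult.assoc)
  have "(LINT z|circle_measure. (LINT w|circle_measure. \<Phi> w * \<kappa> (z * cnj w)) * z powi (- n)) =
      (LINT z|circle_measure. (LINT w|circle_measure. ?I w z))"
    by simp
  also have "\<dots> = (LINT w|circle_measure. (LINT z|circle_measure. ?I w z))"
    using P.Fubini_integral[of "\<lambda>z w. ?I w z"] int by simp
  also have "\<dots> = (LINT w|circle_measure.
      \<Phi> w * w powi (- n) * (LINT z|circle_measure. \<kappa> z * z powi (- n)))"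
    by (intro Bochner_Integration.integral_cong refl) (simp only: inner space_circle_measure mem_sphere_0)
  also have "\<dots> = (LINT w|circle_measure. \<Phi> w * w powi (- n)) *
      (LINT z|circle_measure. \<kappa> z * z powi (- n))"
    by simp
  finally have *: "(LINT z|circle_measure. (LINT w|circle_measure. \<Phi> w * \<kappa> (z * cnj w)) * z powi (- n)) =
    (LINT w|circle_measure. \<Phi> w * w powi (- n)) * (LINT z|circle_measure. \<kappa> z * z powi (- n))" .
  have "fourier_coeff (circle_conv \<Phi> \<kappa>) n = complex_of_real (1 / (2 * pi)) * fourier_coeff
      (\<lambda>z. LINT w|circle_measure. \<Phi> w * \<kappa> (z * cnj w)) n"
    unfolding circle_conv_def by (rule fourier_coeff_cmult)
  then show ?thesis
    unfolding fourier_coeff_def unfolding * by (simp only: mult_ac)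
qed

lemma cmod_circle_conv_le:
  assumes \<Phi>: "\<Phi> \<in> borel_measurable circle_measure" "\<And>z. cmod z = 1 \<Longrightarrow> cmod (\<Phi> z) \<le> A"
    and \<kappa>: "continuous_on UNIV \<kappa>" "\<And>z. cmod z = 1 \<Longrightarrow> cmod (\<kappa> z) \<le> B" and z: "cmod z = 1"
  shows "cmod (circle_conv \<Phi> \<kappa> z) \<le> A * B"
proof -
  let ?f = "\<lambda>w. \<Phi> w * \<kappa> (z * cnj w)"
  have "circle_conv \<Phi> \<kappa> z = fourier_coeff ?f 0"
    by (simp add: circle_conv_def fourier_coeff_def)
  also have "cmod \<dots> \<le> A * B"
  proof (rule cmod_fourier_coeff_le)
    show "?f \<in> borel_measurable circle_measure"
      by (intro borel_measurable_times \<Phi> borel_measurable_circleI continuous_on_compose2[OF \<kappa>(1)]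
          continuous_intros) auto
    show "cmod (?f w) \<le> A * B" if "cmod w = 1" for w
      unfolding norm_mult using that z \<Phi>(2)[OF that]
      by (intro mult_mono \<kappa>) (auto simp: norm_mult intro: order_trans[OF norm_ge_zero])
  qed
  finally show ?thesis .
qed

lemma circle_conv_eq_0:
  assumes "\<And>w. cmod w = 1 \<Longrightarrow> \<Phi> w * \<kappa> (z * cnj w) = 0"
  shows "circle_conv \<Phi> \<kappa> z = 0"
proof -
  have "(LINT w|circle_measure. \<Phi> w * \<kappa> (z * cnj w)) = (LINT w|circle_measure. 0)"
    by (intro Bochner_Integration.integral_cong refl) (simp only: assms space_circle_measure mem_sphere_0)
  then show ?thesis by (simp add: circle_conv_def)
qed

text \<open>
  The bumps are truncated powers of \<open>Re z - c\<close>: for \<open>p \<ge> 3\<close> the second angular derivative of such a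
  bump is a combination of the bumps with exponents \<open>p - 2\<close>, \<open>p - 1\<close> and \<open>p\<close>, which gives both the
  decay of the Fourier coefficients and the support of the derivatives.
\<close>

definition bump :: "real \<Rightarrow> nat \<Rightarrow> complex \<Rightarrow> complex" where
  "bump c p z = complex_of_real ((max 0 (Re z - c)) ^ p)"

definition dbump :: "real \<Rightarrow> nat \<Rightarrow> complex \<Rightarrow> complex" where
  "dbump c p z = complex_of_real (- real p * Im z * (max 0 (Re z - c)) ^ (p - 1))"

text \<open>With \<open>m = cos y - c\<close>, the second derivative of \<open>m ^ p\<close> is
  \<open>p * (p - 1) * m ^ (p - 2) * (sin y)\<^sup>2 - p * m ^ (p - 1) * cos y\<close>; inserting
  \<open>cos y = m + c\<close> and \<open>(sin y)\<^sup>2 = 1 - (m + c)\<^sup>2\<close> gives the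
  three coefficients. The family \<open>f\<close> is a parameter because one more derivative turns
  the identity for \<open>bump c\<close> into the same one for \<open>dbump c\<close>.\<close>

definition second_deriv_comb ::
    "(nat \<Rightarrow> complex \<Rightarrow> complex) \<Rightarrow> real \<Rightarrow> nat \<Rightarrow> complex \<Rightarrow> complex" where
  "second_deriv_comb f c p z =
     complex_of_real (real p * (real p - 1) * (1 - c\<^sup>2)) * f (p - 2) z -
     complex_of_real (c * real p * (2 * real p - 1)) * f (p - 1) z - complex_of_real ((real p)\<^sup>2) * f p z"

lemma continuous_on_bump [continuous_intros]: "continuous_on A (bump c p)"
  unfolding bump_def by (intro continuous_intros)

lemma continuous_on_dbump [continuous_intros]: "continuous_on A (dbump c p)"
  unfolding dbump_def by (intro continuous_intros)

lemma continuous_on_second_deriv_comb: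
  assumes "\<And>p. continuous_on A (f p)"
  shows "continuous_on A (second_deriv_comb f c p)"
  unfolding second_deriv_comb_def by (intro continuous_intros assms)

text \<open>Only the point 0 needs an argument: there the difference quotient is at most
  \<open>\<bar>h\<bar> ^ Suc q\<close>, which tends to 0.\<close>

lemma has_real_derivative_max_power:
  "((\<lambda>x. (max 0 x) ^ Suc (Suc q)) has_real_derivative (real q + 2) * (max 0 x) ^ Suc q) (at x)"
proof -
  consider "x > 0" | "x < 0" | "x = 0" by linarith
  then show ?thesis
  proof cases
    case 1
    have "((\<lambda>x. x ^ Suc (Suc q)) has_real_derivative (real q + 2) * x ^ Suc q) (at x)"
      using DERIV_pow[of "Suc (Suc q)" x] by (simp add: add.commute)
    moreover have "\<forall>\<^sub>F y in nhds x. (max 0 y) ^ Suc (Suc q) = y ^ Suc (Suc q)"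
      using eventually_nhds_in_open[of "{0<..}" x] 1 by (auto elim!: eventually_mono)
    ultimately show ?thesis
      using 1 by (subst DERIV_cong_ev[OF refl _ refl]) auto
  next
    case 2
    have "\<forall>\<^sub>F y in nhds x. (max 0 y) ^ Suc (Suc q) = 0"
      using eventually_nhds_in_open[of "{..<0}" x] 2 by (auto elim!: eventually_mono)
    from DERIV_cong_ev[OF refl this refl, of 0]
    have "((\<lambda>x. (max 0 x) ^ Suc (Suc q)) has_real_derivative 0) (at x)"
      by simp
    then show ?thesis using 2 by simp
  next
    case 3
    have "((\<lambda>h. (max 0 (0 + h)) ^ Suc (Suc q) / h) \<longlongrightarrow> 0) (at (0::real))"
    proof (rule Lim_null_comparison)
      show "\<forall>\<^sub>F h in at (0::real). norm ((max 0 (0 + h)) ^ Suc (Suc q) / h) \<le> \<bar>h\<bar> ^ Suc q"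
      proof (rule always_eventually, rule allI)
        fix h :: real
        show "norm ((max 0 (0 + h)) ^ Suc (Suc q) / h) \<le> \<bar>h\<bar> ^ Suc q"
          by (cases "h > 0") (auto simp: max_def mult_nonpos_nonneg)
      qed
      have "((\<lambda>h::real. \<bar>h\<bar> ^ Suc q) \<longlongrightarrow> \<bar>0\<bar> ^ Suc q) (at 0)"
        by (intro tendsto_intros)
      then show "((\<lambda>h::real. \<bar>h\<bar> ^ Suc q) \<longlongrightarrow> 0) (at 0)" by simp
    qed
    then show ?thesis using 3 by (simp add: DERIV_def)
  qed
qed

lemma bump_has_vector_derivative:
  assumes "p \<ge> 2"
  shows "((\<lambda>y. bump c p (cis y)) has_vector_derivative dbump c p (cis y)) (at y)"
proof -
  obtain q where p: "p = Suc (Suc q)" using assms by (metis Suc_le_D numeral_2_eq_2 Suc_le_mono)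
  have "((\<lambda>y. (max 0 (cos y - c)) ^ p) has_real_derivative
      - real p * sin y * (max 0 (cos y - c)) ^ (p - 1)) (at y)"
    unfolding p
    by (rule DERIV_cong[OF DERIV_chain2[OF has_real_derivative_max_power]])
      (auto intro!: derivative_eq_intros simp: algebra_simps)
  from has_vector_derivative_of_real[OF this] show ?thesis
    by (simp add: bump_def dbump_def)
qed

lemma dbump_has_vector_derivative:
  assumes "p \<ge> 3"
  shows "((\<lambda>y. dbump c p (cis y)) has_vector_derivative second_deriv_comb (bump c) c p (cis y)) (at y)"
proof -
  obtain q where p: "p = Suc (Suc (Suc q))"
    using assms by (metis Suc_le_D numeral_3_eq_3 Suc_le_mono)
  let ?m = "max 0 (cos y - c)"
  have "((\<lambda>y. - real p * sin y * (max 0 (cos y - c)) ^ (p - 1)) has_real_derivative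
      - real p * cos y * ?m ^ Suc (Suc q) + real p * (real q + 2) * (sin y)\<^sup>2 * ?m ^ Suc q) (at y)"
    unfolding p diff_Suc_1
    by (rule DERIV_cong[OF DERIV_mult[OF _ DERIV_chain2[OF has_real_derivative_max_power]]])
      (auto intro!: derivative_eq_intros simp: power2_eq_square algebra_simps)
  also have "- real p * cos y * ?m ^ Suc (Suc q) + real p * (real q + 2) * (sin y)\<^sup>2 * ?m ^ Suc q =
      real p * (real p - 1) * (1 - c\<^sup>2) * ?m ^ (p - 2) - c * real p * (2 * real p - 1) * ?m ^ (p - 1)
        - (real p)\<^sup>2 * ?m ^ p"
  proof (cases "cos y > c")
    case True
    define m where "m = cos y - c"
    have m: "?m = m" "cos y = m + c" "max 0 m = m" using True by (auto simp: m_def)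
    have s: "(sin y)\<^sup>2 = 1 - (m + c)\<^sup>2"
      using sin_cos_squared_add[of y] m(2) by simp
    show ?thesis
      unfolding m(1) s unfolding m(2) by (simp add: p power2_eq_square algebra_simps)
  qed (simp add: p)
  finally have "((\<lambda>y. - real p * sin y * (max 0 (cos y - c)) ^ (p - 1)) has_real_derivative
     real p * (real p - 1) * (1 - c\<^sup>2) * ?m ^ (p - 2) - c * real p * (2 * real p - 1) * ?m ^ (p - 1)
        - (real p)\<^sup>2 * ?m ^ p) (at y)" .
  from has_vector_derivative_of_real[OF this] show ?thesis
    by (simp add: bump_def dbump_def second_deriv_comb_def)
qed

lemma fourier_coeff_dbump:
  "p \<ge> 2 \<Longrightarrow> fourier_coeff (dbump c p) n = \<i> * of_int n * fourier_coeff (bump c p) n"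
  by (intro fourier_coeff_derivative continuous_on_bump continuous_on_dbump bump_has_vector_derivative)

lemma fourier_coeff_second_deriv_comb:
  assumes "\<And>p. continuous_on (sphere 0 1) (f p)"
  shows "fourier_coeff (second_deriv_comb f c p) n =
     complex_of_real (real p * (real p - 1) * (1 - c\<^sup>2)) * fourier_coeff (f (p - 2)) n -
     complex_of_real (c * real p * (2 * real p - 1)) * fourier_coeff (f (p - 1)) n -
     complex_of_real ((real p)\<^sup>2) * fourier_coeff (f p) n"
proof -
  have int: "integrable circle_measure (\<lambda>z. a * f q z)" for a q
    by (intro integrable_circle_continuous continuous_intros assms)
  have int2: "integrable circle_measure (\<lambda>z. a * f q z - b * f r z)" for a q b r
    by (intro integrable_circle_continuous continuous_intros assms)
  show ?thesis
    unfolding second_deriv_comb_def[abs_def]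
    by (simp only: fourier_coeff_diff int int2 fourier_coeff_cmult)
qed

lemma fourier_coeff_bump_second:
  assumes "p \<ge> 3"
  shows "fourier_coeff (second_deriv_comb (bump c) c p) n = - of_int (n\<^sup>2) * fourier_coeff (bump c p) n"
proof -
  have "fourier_coeff (second_deriv_comb (bump c) c p) n = \<i> * of_int n * fourier_coeff (dbump c p) n"
    by (intro fourier_coeff_derivative continuous_on_dbump continuous_on_second_deriv_comb
        continuous_on_bump dbump_has_vector_derivative assms)
  also have "\<dots> = (\<i> * \<i>) * of_int (n\<^sup>2) * fourier_coeff (bump c p) n"
    using assms by (simp only: fourier_coeff_dbump power2_eq_square of_int_mult mult_ac)
  finally show ?thesis by simp
qed

text \<open>No third derivative is computed: the identity for \<open>bump\<close> is multiplied by
  \<open>\<i> * of_int n\<close>. The lowest exponent \<open>p - 2\<close> must be at least 2 for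
  \<open>dbump\<close> to be the derivative of \<open>bump\<close>, whence
  \<open>p \<ge> 4\<close>.\<close>

lemma fourier_coeff_dbump_second:
  assumes "p \<ge> 4"
  shows "fourier_coeff (second_deriv_comb (dbump c) c p) n = - of_int (n\<^sup>2) * fourier_coeff (dbump c p) n"
proof -
  have "fourier_coeff (second_deriv_comb (dbump c) c p) n =
      \<i> * of_int n * fourier_coeff (second_deriv_comb (bump c) c p) n"
    using assms
    by (simp add: fourier_coeff_second_deriv_comb continuous_on_bump continuous_on_dbump
        fourier_coeff_dbump right_diff_distrib mult.left_commute)
  then show ?thesis
    using assms by (simp add: fourier_coeff_dbump fourier_coeff_bump_second)
qed

text \<open>Multiplying the coefficients by \<open>1 + n\<^sup>2\<close> amounts to subtracting the
  second derivative, which lowers the exponent by at most 2. So each power of the weight costs 2 in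
  \<open>p\<close>.\<close>

lemma fourier_coeff_bump_decay:
  "2 * j + 1 \<le> p \<Longrightarrow> \<exists>C. \<forall>n. (1 + (real_of_int n)\<^sup>2) ^ j * cmod (fourier_coeff (bump c p) n) \<le> C"
proof (induction j arbitrary: p)
  case 0
  obtain B where "\<And>z. cmod z = 1 \<Longrightarrow> cmod (bump c p z) \<le> B"
    using continuous_bounded_circle[OF continuous_on_bump] by blast
  then show ?case
    using cmod_fourier_coeff_le[of "bump c p" B]
    by (auto intro!: exI[of _ B] borel_measurable_circleI continuous_on_bump)
next
  case (Suc j)
  let ?D = "\<lambda>p n. (1 + (real_of_int n)\<^sup>2) ^ j * cmod (fourier_coeff (bump c p) n)"
  have "\<exists>C. \<forall>n. ?D q n \<le> C" if "q \<in> {p - 2, p - 1, p}" for q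
    using that Suc.prems by (intro Suc.IH) auto
  then obtain C where C: "\<And>q n. q \<in> {p - 2, p - 1, p} \<Longrightarrow> ?D q n \<le> C q" by metis
  define a where "a = complex_of_real (real p * (real p - 1) * (1 - c\<^sup>2))"
  define b where "b = complex_of_real (c * real p * (2 * real p - 1))"
  define d where "d = 1 + complex_of_real ((real p)\<^sup>2)"
  have "(1 + (real_of_int n)\<^sup>2) ^ Suc j * cmod (fourier_coeff (bump c p) n) \<le>
      cmod a * C (p - 2) + cmod b * C (p - 1) + cmod d * C p" for n
  proof -
    have "of_real (1 + (real_of_int n)\<^sup>2) * fourier_coeff (bump c p) n =
       fourier_coeff (bump c p) n - fourier_coeff (second_deriv_comb (bump c) c p) n"
      using Suc.prems by (simp add: fourier_coeff_bump_second algebra_simps)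
    also have "\<dots> = d * fourier_coeff (bump c p) n + b * fourier_coeff (bump c (p - 1)) n
        - a * fourier_coeff (bump c (p - 2)) n"
      by (simp add: fourier_coeff_second_deriv_comb continuous_on_bump a_def b_def d_def algebra_simps)
    finally have eq: "of_real (1 + (real_of_int n)\<^sup>2) * fourier_coeff (bump c p) n = \<dots>" .
    have "(1 + (real_of_int n)\<^sup>2) * cmod (fourier_coeff (bump c p) n) =
       cmod (of_real (1 + (real_of_int n)\<^sup>2) * fourier_coeff (bump c p) n)"
      unfolding norm_mult norm_of_real by (simp add: add_nonneg_nonneg)
    also have "\<dots> \<le> cmod d * cmod (fourier_coeff (bump c p) n) +
        cmod b * cmod (fourier_coeff (bump c (p - 1)) n) + cmod a * cmod (fourier_coeff (bump c (p - 2)) n)"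
      unfolding eq norm_mult[symmetric]
      by (meson add_right_mono norm_triangle_ineq norm_triangle_ineq4 order_trans)
    finally have "(1 + (real_of_int n)\<^sup>2) ^ j * ((1 + (real_of_int n)\<^sup>2) * cmod (fourier_coeff (bump c p) n)) \<le>
       (1 + (real_of_int n)\<^sup>2) ^ j * (cmod d * cmod (fourier_coeff (bump c p) n) +
        cmod b * cmod (fourier_coeff (bump c (p - 1)) n) + cmod a * cmod (fourier_coeff (bump c (p - 2)) n))"
      by (intro mult_left_mono) auto
    also have "\<dots> = cmod a * ?D (p - 2) n + cmod b * ?D (p - 1) n + cmod d * ?D p n"
      by (simp add: algebra_simps)
    also have "\<dots> \<le> cmod a * C (p - 2) + cmod b * C (p - 1) + cmod d * C p"
      by (intro add_mono mult_left_mono C) auto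
    finally show ?thesis by (simp add: mult_ac)
  qed
  then show ?case by blast
qed

lemma abs_le_one_plus_square: "\<bar>real_of_int n\<bar> \<le> 1 + (real_of_int n)\<^sup>2"
  using sum_squares_bound[of "\<bar>real_of_int n\<bar>" 1] by auto

text \<open>The extra factor \<open>\<bar>n\<bar>\<close> is absorbed by one more power of the
  weight, hence 2 more in the exponent than for \<open>bump\<close>.\<close>

lemma fourier_coeff_dbump_decay:
  assumes "2 * j + 3 \<le> p"
  shows "\<exists>C. \<forall>n. (1 + (real_of_int n)\<^sup>2) ^ j * cmod (fourier_coeff (dbump c p) n) \<le> C"
proof -
  obtain C where C: "\<And>n. (1 + (real_of_int n)\<^sup>2) ^ Suc j * cmod (fourier_coeff (bump c p) n) \<le> C"
    using fourier_coeff_bump_decay[of "Suc j" p c] assms by auto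
  have "(1 + (real_of_int n)\<^sup>2) ^ j * cmod (fourier_coeff (dbump c p) n) \<le> C" for n
  proof -
    have "(1 + (real_of_int n)\<^sup>2) ^ j * cmod (fourier_coeff (dbump c p) n) \<le>
        (1 + (real_of_int n)\<^sup>2) ^ j * ((1 + (real_of_int n)\<^sup>2) * cmod (fourier_coeff (bump c p) n))"
      using assms abs_le_one_plus_square[of n]
      by (intro mult_left_mono) (auto simp: fourier_coeff_dbump norm_mult intro: mult_right_mono)
    also have "\<dots> \<le> C" using C[of n] by (simp add: mult_ac)
    finally show ?thesis .
  qed
  then show ?thesis by blast
qed

section \<open>Steered initial data\<close>

lemma summable_on_inverse_square_int: "(\<lambda>n::int. 1 / (1 + (real_of_int n)\<^sup>2)) summable_on UNIV"
proof -
  let ?f = "\<lambda>n::int. 1 / (1 + (real_of_int n)\<^sup>2)"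
  have *: "(\<lambda>n::nat. 1 / (1 + (real n)\<^sup>2)) summable_on UNIV"
  proof (rule norm_summable_imp_summable_on, rule summable_comparison_test_ev)
    show "summable (\<lambda>n. inverse (real n ^ 2))" by (rule inverse_power_summable) simp
    show "\<forall>\<^sub>F n in sequentially. norm (norm (1 / (1 + (real n)\<^sup>2))) \<le> inverse (real n ^ 2)"
      using eventually_gt_at_top[of 0]
      by eventually_elim (auto simp: divide_simps add_pos_nonneg)
  qed
  have "?f summable_on range int"
    using * by (subst summable_on_reindex) (auto simp: o_def)
  moreover have "?f summable_on range (\<lambda>n. - int n - 1)"
  proof (subst summable_on_reindex)
    show "(?f \<circ> (\<lambda>n. - int n - 1)) summable_on UNIV"
    proof (rule summable_on_comparison_test[OF *])
      fix n :: nat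
      have "(real n)\<^sup>2 \<le> (- real n - 1)\<^sup>2" by (simp add: power2_eq_square algebra_simps)
      then show "(?f \<circ> (\<lambda>n. - int n - 1)) n \<le> 1 / (1 + (real n)\<^sup>2)"
        by (auto simp: intro!: divide_left_mono mult_pos_pos add_pos_nonneg)
    qed auto
  qed (auto simp: inj_on_def)
  ultimately have "?f summable_on (range int \<union> range (\<lambda>n. - int n - 1))"
    by (rule summable_on_Un_disjoint) auto
  also have "range int \<union> range (\<lambda>n. - int n - 1) = UNIV"
  proof -
    have "x \<in> range int \<union> range (\<lambda>n. - int n - 1)" for x
    proof (cases x rule: int_cases)
      case (neg m)
      then have "x = - int m - 1" by simp
      then show ?thesis by blast
    qed blast
    then show ?thesis by blast
  qed
  finally show ?thesis .
qed

lemma summable_on_decay_int: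
  fixes f :: "int \<Rightarrow> real"
  assumes "\<And>n. (1 + (real_of_int n)\<^sup>2) * \<bar>f n\<bar> \<le> C"
  shows "f summable_on UNIV"
proof (rule abs_summable_summable, rule summable_on_comparison_test)
  show "(\<lambda>n::int. C * (1 / (1 + (real_of_int n)\<^sup>2))) summable_on UNIV"
    by (intro summable_on_cmult_right summable_on_inverse_square_int)
  show "norm (f n) \<le> C * (1 / (1 + (real_of_int n)\<^sup>2))" for n
    using assms[of n] by (simp add: add_pos_nonneg pos_le_divide_eq mult.commute)
qed auto

definition sobolev_coeff :: "nat \<Rightarrow> (int \<Rightarrow> complex) \<Rightarrow> bool" where
  "sobolev_coeff k a \<longleftrightarrow> (\<lambda>n. (1 + (real_of_int n)\<^sup>2) ^ k * (cmod (a n))\<^sup>2) summable_on UNIV"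

text \<open>One factor \<open>cmod (a n)\<close> takes up the weight of order \<open>k + 1\<close>
  and the other is merely bounded. The surplus power of \<open>1 + n\<^sup>2\<close> is what makes
  the series converge.\<close>

lemma decay_imp_sobolev:
  assumes "\<And>n. (1 + (real_of_int n)\<^sup>2) ^ Suc k * cmod (a n) \<le> C"
  shows "(\<lambda>n. cmod (a n)) summable_on UNIV" "sobolev_coeff k a"
proof -
  have x1: "1 \<le> (1 + (real_of_int n)\<^sup>2) ^ j" for n j
    by (rule one_le_power) simp
  have 1: "(1 + (real_of_int n)\<^sup>2) * cmod (a n) \<le> C" for n
  proof -
    have "1 * ((1 + (real_of_int n)\<^sup>2) * cmod (a n)) \<le> (1 + (real_of_int n)\<^sup>2) ^ k * ((1 + (real_of_int n)\<^sup>2) * cmod (a n))"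
      using x1 by (intro mult_right_mono) auto
    then show ?thesis using assms[of n] by (simp add: mult_ac)
  qed
  then show "(\<lambda>n. cmod (a n)) summable_on UNIV"
    by (intro summable_on_decay_int[of _ C]) simp
  have 2: "cmod (a n) \<le> C" for n
    using 1[of n] x1[of n 1] mult_right_mono[of 1 "1 + (real_of_int n)\<^sup>2" "cmod (a n)"] by simp
  show "sobolev_coeff k a"
    unfolding sobolev_coeff_def
  proof (rule summable_on_decay_int[of _ "C * C"])
    fix n
    have "(1 + (real_of_int n)\<^sup>2) * \<bar>(1 + (real_of_int n)\<^sup>2) ^ k * (cmod (a n))\<^sup>2\<bar> =
        ((1 + (real_of_int n)\<^sup>2) ^ Suc k * cmod (a n)) * cmod (a n)"
      by (simp add: abs_mult power2_eq_square mult_ac)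
    also have "\<dots> \<le> C * C"
      using assms[of n] 2[of n] by (intro mult_mono) (auto intro: order_trans[OF norm_ge_zero])
    finally show "(1 + (real_of_int n)\<^sup>2) * \<bar>(1 + (real_of_int n)\<^sup>2) ^ k * (cmod (a n))\<^sup>2\<bar> \<le> C * C" .
  qed
qed

text \<open>
  A function \<open>w\<close> living on \<open>\<omega>\<close> together with its second angular derivative \<open>v\<close>, which is described by
  its Fourier coefficients only.
\<close>
definition angular_pair ::
    "complex set \<Rightarrow> nat \<Rightarrow> (complex \<Rightarrow> complex) \<Rightarrow> (complex \<Rightarrow> complex) \<Rightarrow> bool" where
  "angular_pair \<omega> k w v \<longleftrightarrow>
     w \<in> borel_measurable circle_measure \<and> v \<in> borel_measurable circle_measure \<and>
     (\<exists>B. \<forall>z. cmod z = 1 \<longrightarrow> cmod (w z) \<le> B \<and> cmod (v z) \<le> B) \<and>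
     (\<forall>z. cmod z = 1 \<and> z \<notin> \<omega> \<longrightarrow> w z = 0 \<and> v z = 0) \<and>
     (\<forall>n. fourier_coeff v n = - of_int (n\<^sup>2) * fourier_coeff w n) \<and>
     (\<exists>C. \<forall>n. (1 + (real_of_int n)\<^sup>2) ^ Suc (Suc k) * cmod (fourier_coeff w n) \<le> C)"

lemma angular_pair_integrable:
  assumes "angular_pair \<omega> k w v"
  shows "integrable circle_measure w" "integrable circle_measure v"
  using assms unfolding angular_pair_def by (auto intro: integrable_circle)

text \<open>These are the coefficients of \<open>w\<^sub>1 - |D| w\<^sub>0\<close>, the initial
  value of \<open>(\<partial>\<^sub>t - |D|) w\<close> when \<open>w\<close> starts from
  \<open>w\<^sub>0\<close> with velocity \<open>w\<^sub>1\<close>.\<close>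

definition steered_coeff :: "(complex \<Rightarrow> complex) \<Rightarrow> (complex \<Rightarrow> complex) \<Rightarrow> int \<Rightarrow> complex" where
  "steered_coeff w\<^sub>0 w\<^sub>1 n = fourier_coeff w\<^sub>1 n - of_int \<bar>n\<bar> * fourier_coeff w\<^sub>0 n"

text \<open>The factor \<open>\<bar>n\<bar>\<close> consumes one of the \<open>k + 2\<close> powers
  provided by \<open>angular_pair\<close>; the \<open>k + 1\<close> left are those that
  \<open>decay_imp_sobolev\<close> asks for.\<close>

lemma steered_coeff_decay:
  assumes "angular_pair \<omega> k w\<^sub>0 v\<^sub>0" "angular_pair \<omega> k w\<^sub>1 v\<^sub>1"
  obtains C where "\<And>n. (1 + (real_of_int n)\<^sup>2) ^ Suc k * cmod (steered_coeff w\<^sub>0 w\<^sub>1 n) \<le> C"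
proof -
  from assms obtain C0 C1 where
    C: "\<And>n. (1 + (real_of_int n)\<^sup>2) ^ Suc (Suc k) * cmod (fourier_coeff w\<^sub>0 n) \<le> C0"
       "\<And>n. (1 + (real_of_int n)\<^sup>2) ^ Suc (Suc k) * cmod (fourier_coeff w\<^sub>1 n) \<le> C1"
    unfolding angular_pair_def by metis
  have "(1 + (real_of_int n)\<^sup>2) ^ Suc k * cmod (steered_coeff w\<^sub>0 w\<^sub>1 n) \<le> C1 + C0" for n
  proof -
    let ?x = "1 + (real_of_int n)\<^sup>2"
    have x: "1 \<le> ?x" "\<bar>real_of_int n\<bar> \<le> ?x"
      using abs_le_one_plus_square by auto
    have "cmod (steered_coeff w\<^sub>0 w\<^sub>1 n) \<le> cmod (fourier_coeff w\<^sub>1 n) + \<bar>real_of_int n\<bar> * cmod (fourier_coeff w\<^sub>0 n)"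
      unfolding steered_coeff_def using norm_triangle_ineq4[of "fourier_coeff w\<^sub>1 n" "of_int \<bar>n\<bar> * fourier_coeff w\<^sub>0 n"]
      by (simp add: norm_mult)
    also have "\<dots> \<le> ?x * cmod (fourier_coeff w\<^sub>1 n) + ?x * cmod (fourier_coeff w\<^sub>0 n)"
      using x mult_right_mono[OF x(1), of "cmod (fourier_coeff w\<^sub>1 n)"]
      by (intro add_mono mult_right_mono) auto
    finally have "?x ^ Suc k * cmod (steered_coeff w\<^sub>0 w\<^sub>1 n) \<le>
        ?x ^ Suc k * (?x * cmod (fourier_coeff w\<^sub>1 n) + ?x * cmod (fourier_coeff w\<^sub>0 n))"
      by (intro mult_left_mono) auto
    also have "\<dots> = ?x ^ Suc (Suc k) * cmod (fourier_coeff w\<^sub>1 n) + ?x ^ Suc (Suc k) * cmod (fourier_coeff w\<^sub>0 n)"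
      by (simp add: algebra_simps)
    also have "\<dots> \<le> C1 + C0" by (intro add_mono C)
    finally show ?thesis .
  qed
  then show ?thesis by (rule that)
qed

text \<open>This is the factorisation on a single frequency \<open>N\<close>:
  \<open>g'' - N\<^sup>2 * g\<close> arises from \<open>g' - N * g\<close> by differentiating and
  adding \<open>N\<close> times it, so the integrand is the derivative of
  \<open>exp (- (N * (T - s))) * (g' s - N * g s)\<close>.\<close>

lemma half_heat_time_integral:
  fixes g :: "real \<Rightarrow> real" and T :: real
  assumes "0 \<le> T"
    and g: "\<And>s. (g has_real_derivative g' s) (at s)" "\<And>s. (g' has_real_derivative g'' s) (at s)"
    and c: "continuous_on UNIV g''" and T: "g T = 0" "g' T = 0"
  shows "(LINT s|restrict_space lborel {0..T}. exp (- (N * (T - s))) * (g'' s - N\<^sup>2 * g s)) =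
     - (exp (- (N * T)) * (g' 0 - N * g 0))"
proof -
  let ?F = "\<lambda>s. exp (- (N * (T - s))) * (g' s - N * g s)"
  let ?f = "\<lambda>s. exp (- (N * (T - s))) * (g'' s - N\<^sup>2 * g s)"
  have "(LINT s|restrict_space lborel {0..T}. ?f s) = (LINT s|lborel. indicator {0..T} s *\<^sub>R ?f s)"
    by (rule integral_restrict_space) simp
  also have "\<dots> = ?F T - ?F 0"
  proof (rule integral_FTC_atLeastAtMost[OF assms(1)])
    fix s
    have "(?F has_real_derivative ?f s) (at s)"
      by (rule derivative_eq_intros g refl | simp add: power2_eq_square algebra_simps)+
    then show "(?F has_vector_derivative ?f s) (at s within {0..T})"
      by (simp add: has_real_derivative_iff_has_vector_derivative has_vector_derivative_at_within)
  next
    have "continuous_on {0..T} g''" using c by (rule continuous_on_subset) auto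
    moreover have "continuous_on {0..T} g"
      using g(1) by (intro DERIV_continuous_on) (rule has_field_derivative_at_within)
    ultimately show "continuous_on {0..T} ?f"
      by (intro continuous_intros)
  qed
  finally show ?thesis by (simp add: T)
qed

lemma finite_measure_control_domain:
  fixes T :: real
  assumes "\<omega> \<in> sets circle_measure"
  shows "finite_measure (restrict_space lborel {0..T} \<Otimes>\<^sub>M restrict_space circle_measure \<omega>)"
  using assms
  by (intro finite_measure_pair_measure finite_measure_restrict_lborel[of _ 0 T]
      finite_measure_restrict_space circle.finite_measure_axioms) auto

text \<open>
  With \<open>w s = a s * w\<^sub>0 + b s * w\<^sub>1\<close>, where \<open>a\<close> and \<open>b\<close> vanish to third order at \<open>T\<close>, the function
  \<open>(\<partial>\<^sub>t - |D|) w\<close> vanishes at time \<open>T\<close>, equals \<open>w\<^sub>1 - |D| w\<^sub>0\<close> at time \<open>0\<close> and solves the equation with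
  the control \<open>(\<partial>\<^sub>t + |D|) (\<partial>\<^sub>t - |D|) w = \<partial>\<^sub>t\<^sup>2 w + \<partial>\<^sub>y\<^sup>2 w\<close>, which, unlike \<open>|D| w\<close>, stays supported in \<open>\<omega>\<close>.
\<close>
lemma steered_data_null_controllable:
  assumes \<omega>: "\<omega> \<in> sets circle_measure" and T: "T > 0"
    and p0: "angular_pair \<omega> k w\<^sub>0 v\<^sub>0" and p1: "angular_pair \<omega> k w\<^sub>1 v\<^sub>1"
  shows "fourier_series (steered_coeff w\<^sub>0 w\<^sub>1) \<in> null_controllable_L2 \<omega> T \<inter> sobolev k"
    and "fourier_coeff (fourier_series (steered_coeff w\<^sub>0 w\<^sub>1)) n = steered_coeff w\<^sub>0 w\<^sub>1 n"
proof -
  define c where "c = steered_coeff w\<^sub>0 w\<^sub>1"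
  obtain C where C: "\<And>n. (1 + (real_of_int n)\<^sup>2) ^ Suc k * cmod (c n) \<le> C"
    using steered_coeff_decay[OF p0 p1] unfolding c_def by blast
  have sc: "(\<lambda>n. cmod (c n)) summable_on UNIV" and kc: "sobolev_coeff k c"
    using decay_imp_sobolev[OF C] by auto
  have fc: "fourier_coeff (fourier_series c) n = c n" for n
    by (rule fourier_coeff_fourier_series[OF sc])
  then show "fourier_coeff (fourier_series (steered_coeff w\<^sub>0 w\<^sub>1)) n = steered_coeff w\<^sub>0 w\<^sub>1 n"
    by (simp add: c_def)
  have cont: "continuous_on (sphere 0 1) (fourier_series c)"
    by (rule continuous_on_fourier_series[OF sc])
  have L2: "fourier_series c \<in> L2 circle_measure"
  proof -
    have "integrable circle_measure (\<lambda>z. fourier_series c z * cnj (fourier_series c z))"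
      by (intro integrable_circle_continuous continuous_intros cont)
    then have "integrable circle_measure (\<lambda>z. complex_of_real ((cmod (fourier_series c z))\<^sup>2))"
      by (simp only: complex_norm_square)
    then show ?thesis
      using borel_measurable_circleI[OF cont] integrable_Re by (fastforce simp: L2_def)
  qed
  have sob: "fourier_series c \<in> sobolev k"
    using L2 kc by (simp add: sobolev_def sobolev_coeff_def fc)

  define r where "r s = 1 - s / T" for s
  have dr: "(r has_real_derivative - (1 / T)) (at s)" for s
    unfolding r_def using T by (auto intro!: derivative_eq_intros)
  have cr: "continuous_on S r" for S
    unfolding r_def by (intro continuous_intros) (use T in simp)
  \<comment> \<open>The cube of \<open>r\<close> makes value, first and second derivative vanish at
    \<open>T\<close>. The combinations with \<open>r s ^ 4\<close> are fixed by the data at time 0: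
    value 1 and slope 0 for \<open>a\<close>, value 0 and slope 1 for \<open>b\<close>.\<close>
  define a b where "a s = 4 * r s ^ 3 - 3 * r s ^ 4"
    and "b s = T * (r s ^ 3 - r s ^ 4)" for s
  define a' b' where "a' s = - (1 / T) * (12 * (r s)\<^sup>2 - 12 * r s ^ 3)"
    and "b' s = - (3 * (r s)\<^sup>2 - 4 * r s ^ 3)" for s
  define a'' b'' where "a'' s = (1 / T\<^sup>2) * (24 * r s - 36 * (r s)\<^sup>2)"
    and "b'' s = (1 / T) * (6 * r s - 12 * (r s)\<^sup>2)" for s
  note defs = r_def a_def b_def a'_def b'_def a''_def b''_def
  have da: "(a has_real_derivative a' s) (at s)" "(a' has_real_derivative a'' s) (at s)" for s
    unfolding a_def b_def a'_def b'_def a''_def b''_def using T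
    by (auto intro!: derivative_eq_intros dr simp: field_simps power2_eq_square)
  have db: "(b has_real_derivative b' s) (at s)" "(b' has_real_derivative b'' s) (at s)" for s
    unfolding a_def b_def a'_def b'_def a''_def b''_def using T
    by (auto intro!: derivative_eq_intros dr simp: field_simps power2_eq_square)
  have cn: "continuous_on S a" "continuous_on S b" "continuous_on S a''" "continuous_on S b''" for S
    unfolding a_def b_def a''_def b''_def by (intro continuous_intros cr)+
  have vT: "a T = 0" "a' T = 0" "a'' T = 0" "b T = 0" "b' T = 0" "b'' T = 0"
    using T by (auto simp: defs)
  have v0: "a 0 = 1" "a' 0 = 0" "b 0 = 0" "b' 0 = 1"
    using T by (auto simp: defs)
  have "\<exists>K. \<forall>s\<in>{0..T}. \<bar>f s\<bar> \<le> K" if "continuous_on {0..T} f" for f :: "real \<Rightarrow> real"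
    using compact_imp_bounded[OF compact_continuous_image[OF that compact_Icc]]
    by (auto simp: bounded_iff)
  with cn obtain Ka Kb Ka2 Kb2 where "\<forall>s\<in>{0..T}. \<bar>a s\<bar> \<le> Ka" "\<forall>s\<in>{0..T}. \<bar>b s\<bar> \<le> Kb"
    "\<forall>s\<in>{0..T}. \<bar>a'' s\<bar> \<le> Ka2" "\<forall>s\<in>{0..T}. \<bar>b'' s\<bar> \<le> Kb2" by metis
  then have "\<exists>K\<ge>0. \<forall>s\<in>{0..T}. \<bar>a s\<bar> \<le> K \<and> \<bar>b s\<bar> \<le> K \<and> \<bar>a'' s\<bar> \<le> K \<and> \<bar>b'' s\<bar> \<le> K"
    by (intro exI[of _ "max 0 (max (max Ka Kb) (max Ka2 Kb2))"]) force
  then obtain K where K0: "K \<ge> 0" and K: "\<And>s. s \<in> {0..T} \<Longrightarrow> \<bar>a s\<bar> \<le> K" "\<And>s. s \<in> {0..T} \<Longrightarrow> \<bar>b s\<bar> \<le> K"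
     "\<And>s. s \<in> {0..T} \<Longrightarrow> \<bar>a'' s\<bar> \<le> K" "\<And>s. s \<in> {0..T} \<Longrightarrow> \<bar>b'' s\<bar> \<le> K" by blast

  define u where "u x = of_real (a'' (fst x)) * w\<^sub>0 (snd x) + of_real (a (fst x)) * v\<^sub>0 (snd x) +
      of_real (b'' (fst x)) * w\<^sub>1 (snd x) + of_real (b (fst x)) * v\<^sub>1 (snd x)" for x :: "real \<times> complex"
  have meas: "w\<^sub>0 \<in> borel_measurable circle_measure" "v\<^sub>0 \<in> borel_measurable circle_measure"
    "w\<^sub>1 \<in> borel_measurable circle_measure" "v\<^sub>1 \<in> borel_measurable circle_measure"
    using p0 p1 by (auto simp: angular_pair_def)
  from p0 p1 obtain B0 B1 where
    B: "\<And>z. cmod z = 1 \<Longrightarrow> cmod (w\<^sub>0 z) \<le> B0 \<and> cmod (v\<^sub>0 z) \<le> B0"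
       "\<And>z. cmod z = 1 \<Longrightarrow> cmod (w\<^sub>1 z) \<le> B1 \<and> cmod (v\<^sub>1 z) \<le> B1"
    unfolding angular_pair_def by metis
  let ?P = "restrict_space lborel {0..T} \<Otimes>\<^sub>M restrict_space circle_measure \<omega>"
  interpret P: finite_measure ?P
    by (rule finite_measure_control_domain[OF \<omega>])
  have uL2: "u \<in> L2 ?P"
  proof -
    have t: "(\<lambda>x. complex_of_real (f (fst x))) \<in> borel_measurable ?P" if "continuous_on UNIV f" for f
    proof -
      have "f \<in> borel_measurable (restrict_space lborel {0..T})"
        using borel_measurable_continuous_onI[OF that] by (intro measurable_restrict_space1) simp
      moreover have "(complex_of_real :: real \<Rightarrow> complex) \<in> borel_measurable borel"
        by (intro borel_measurable_continuous_onI continuous_intros)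
      ultimately show ?thesis
        by (rule measurable_compose[OF measurable_compose[OF measurable_fst]])
    qed
    have z: "(\<lambda>x. f (snd x)) \<in> borel_measurable ?P"
      if "f \<in> borel_measurable circle_measure" for f :: "complex \<Rightarrow> complex"
      using measurable_compose[OF measurable_snd measurable_restrict_space1[OF that]] .
    have um: "u \<in> borel_measurable ?P"
      unfolding u_def by (intro borel_measurable_add borel_measurable_times t z cn meas)
    have "cmod (u x) \<le> K * B0 + K * B0 + K * B1 + K * B1" if xP: "x \<in> space ?P" for x
    proof -
      obtain s z where x: "x = (s, z)" "s \<in> {0..T}" "cmod z = 1"
        using xP by (auto simp: space_pair_measure space_restrict_space)
      show ?thesis
        unfolding u_def x fst_conv snd_conv using K[OF x(2)] B(1,2)[OF x(3)] K0
        by (intro norm_triangle_mono) (auto simp: norm_mult intro!: mult_mono)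
    qed
    then have "\<And>x. x \<in> space ?P \<Longrightarrow> (cmod (u x))\<^sup>2 \<le> (K * B0 + K * B0 + K * B1 + K * B1)\<^sup>2"
      by (intro power_mono) auto
    then have "integrable ?P (\<lambda>x. (cmod (u x))\<^sup>2)"
      using um by (intro P.integrable_const_bound[where B = "(K * B0 + K * B0 + K * B1 + K * B1)\<^sup>2"] AE_I2) auto
    with um show ?thesis by (simp add: L2_def)
  qed

  \<comment> \<open>Written as the square of \<open>\<bar>n\<bar>\<close> to match the time integral
    with \<open>N = \<bar>n\<bar>\<close>.\<close>
  let ?n2 = "\<lambda>n. (\<bar>real_of_int n\<bar>)\<^sup>2"
  define E where "E n s = exp (- (\<bar>real_of_int n\<bar> * (T - s)))" for n s
  \<comment> \<open>\<open>G z n s\<close> is the contribution of frequency \<open>n\<close> to the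
    Duhamel integrand at time \<open>s\<close> and point \<open>z\<close>.\<close>
  define G where "G z n s = fourier_coeff w\<^sub>0 n * z powi n * of_real (E n s * (a'' s - ?n2 n * a s)) +
      fourier_coeff w\<^sub>1 n * z powi n * of_real (E n s * (b'' s - ?n2 n * b s))" for z n s
  have fu: "fourier_coeff (\<lambda>w. if w \<in> \<omega> then u (s, w) else 0) n =
      of_real (a'' s - ?n2 n * a s) * fourier_coeff w\<^sub>0 n + of_real (b'' s - ?n2 n * b s) * fourier_coeff w\<^sub>1 n" for s n
  proof -
    have "fourier_coeff (\<lambda>w. if w \<in> \<omega> then u (s, w) else 0) n =
      fourier_coeff (\<lambda>w. ((of_real (a'' s) * w\<^sub>0 w + of_real (a s) * v\<^sub>0 w) + of_real (b'' s) * w\<^sub>1 w) + of_real (b s) * v\<^sub>1 w) n"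
      using p0 p1 by (intro fourier_coeff_cong) (auto simp: u_def angular_pair_def)
    also have "\<dots> = of_real (a'' s) * fourier_coeff w\<^sub>0 n + of_real (a s) * fourier_coeff v\<^sub>0 n +
       of_real (b'' s) * fourier_coeff w\<^sub>1 n + of_real (b s) * fourier_coeff v\<^sub>1 n"
      by (simp add: fourier_coeff_add fourier_coeff_cmult Bochner_Integration.integrable_add integrable_mult_right
          angular_pair_integrable[OF p0] angular_pair_integrable[OF p1])
    also have "fourier_coeff v\<^sub>0 n = - of_int (n\<^sup>2) * fourier_coeff w\<^sub>0 n"
      using p0 by (simp add: angular_pair_def)
    also have "fourier_coeff v\<^sub>1 n = - of_int (n\<^sup>2) * fourier_coeff w\<^sub>1 n"
      using p1 by (simp add: angular_pair_def)
    finally show ?thesis by (simp add: algebra_simps)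
  qed
  have semi: "half_heat_semigroup (T - s) (\<lambda>w. if w \<in> \<omega> then u (s, w) else 0) z = (\<Sum>\<^sub>\<infinity>n. G z n s)"
    if s: "s \<in> {0..T}" for s z
  \<comment> \<open>At \<open>s = T\<close> the semigroup is the identity by its case distinction,
    not a series. Both sides are 0 there because \<open>a\<close>, \<open>b\<close> and their second
    derivatives vanish at \<open>T\<close>.\<close>
  proof (cases "s = T")
    case True
    then show ?thesis by (simp add: half_heat_semigroup_def u_def G_def vT)
  next
    case False
    have e: "exp (- complex_of_real (\<bar>real_of_int n\<bar> * (T - s))) = of_real (E n s)" for n
      unfolding E_def by (simp only: of_real_minus[symmetric] exp_of_real)
    have "fourier_coeff (\<lambda>w. if w \<in> \<omega> then u (s, w) else 0) n *
        exp (- complex_of_real (\<bar>real_of_int n\<bar> * (T - s))) * z powi n = G z n s" for n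
      unfolding fu e G_def of_real_mult[of "E n s"] distrib_right by (simp only: mult_ac)
    then show ?thesis using False by (simp add: half_heat_semigroup_def)
  qed

  from p0 p1 obtain C0 C1 where
    Cw: "\<And>n. (1 + (real_of_int n)\<^sup>2) ^ Suc (Suc k) * cmod (fourier_coeff w\<^sub>0 n) \<le> C0"
        "\<And>n. (1 + (real_of_int n)\<^sup>2) ^ Suc (Suc k) * cmod (fourier_coeff w\<^sub>1 n) \<le> C1"
    unfolding angular_pair_def by metis
  \<comment> \<open>The heat factor is at most 1 and the time factor at most
    \<open>K * (1 + n\<^sup>2)\<close>. Decay of order at least 2 in \<open>1 + n\<^sup>2\<close>
    leaves one power to sum this majorant.\<close>
  define D where "D n = (cmod (fourier_coeff w\<^sub>0 n) + cmod (fourier_coeff w\<^sub>1 n)) * (K * (1 + (real_of_int n)\<^sup>2))" for n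
  have D: "D summable_on UNIV"
  proof (rule summable_on_decay_int[of _ "K * (C0 + C1)"])
    fix n
    let ?x = "1 + (real_of_int n)\<^sup>2"
    have x2: "?x\<^sup>2 \<le> ?x ^ Suc (Suc k)"
      by (intro power_increasing) auto
    have *: "?x\<^sup>2 * cmod y \<le> C'" if "?x ^ Suc (Suc k) * cmod y \<le> C'" for C' and y :: complex
      using mult_right_mono[OF x2, of "cmod y"] that by simp
    have "D n \<ge> 0" unfolding D_def using K0 by simp
    then have "?x * \<bar>D n\<bar> = K * (?x\<^sup>2 * cmod (fourier_coeff w\<^sub>0 n) + ?x\<^sup>2 * cmod (fourier_coeff w\<^sub>1 n))"
      by (simp add: D_def power2_eq_square algebra_simps)
    also have "\<dots> \<le> K * (C0 + C1)"
      using K0 by (intro mult_left_mono add_mono * Cw)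
    finally show "?x * \<bar>D n\<bar> \<le> K * (C0 + C1)" .
  qed
  have GD: "cmod (G z n s) \<le> D n" if s: "s \<in> {0..T}" and z: "cmod z = 1" for n s z
  proof -
    have "E n s \<le> 1" "E n s \<ge> 0" using s by (auto simp: E_def)
    have bd: "\<bar>E n s * (p - ?n2 n * q)\<bar> \<le> K * (1 + (real_of_int n)\<^sup>2)" if "\<bar>p\<bar> \<le> K" "\<bar>q\<bar> \<le> K" for p q
    proof -
      have "\<bar>E n s * (p - ?n2 n * q)\<bar> \<le> 1 * \<bar>p - ?n2 n * q\<bar>"
        unfolding abs_mult using \<open>E n s \<le> 1\<close> \<open>E n s \<ge> 0\<close> by (intro mult_right_mono) auto
      also have "\<dots> \<le> \<bar>p\<bar> + ?n2 n * \<bar>q\<bar>"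
        using abs_triangle_ineq4[of p "?n2 n * q"] by (simp add: abs_mult)
      also have "\<dots> \<le> K + ?n2 n * K"
        using that by (intro add_mono mult_left_mono) auto
      finally show ?thesis by (simp add: algebra_simps)
    qed
    have "cmod (G z n s) \<le> cmod (fourier_coeff w\<^sub>0 n) * (K * (1 + (real_of_int n)\<^sup>2)) +
        cmod (fourier_coeff w\<^sub>1 n) * (K * (1 + (real_of_int n)\<^sup>2))"
      unfolding G_def
    proof (rule norm_triangle_mono)
      show "cmod (fourier_coeff w\<^sub>0 n * z powi n * of_real (E n s * (a'' s - ?n2 n * a s))) \<le>
        cmod (fourier_coeff w\<^sub>0 n) * (K * (1 + (real_of_int n)\<^sup>2))"
        unfolding norm_mult[of "_ * _ powi _"] norm_of_real norm_mult[of _ "_ powi _"] cmod_powi_circle[OF z] mult_1_right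
        using bd K[OF s] by (intro mult_left_mono) auto
      show "cmod (fourier_coeff w\<^sub>1 n * z powi n * of_real (E n s * (b'' s - ?n2 n * b s))) \<le>
        cmod (fourier_coeff w\<^sub>1 n) * (K * (1 + (real_of_int n)\<^sup>2))"
        unfolding norm_mult[of "_ * _ powi _"] norm_of_real norm_mult[of _ "_ powi _"] cmod_powi_circle[OF z] mult_1_right
        using bd K[OF s] by (intro mult_left_mono) auto
    qed
    then show ?thesis by (simp add: D_def algebra_simps)
  qed
  let ?R = "restrict_space lborel {0..T}"
  interpret R: finite_measure ?R
    by (rule finite_measure_restrict_lborel[of _ 0 T]) auto
  have cE: "continuous_on UNIV (E n)" for n
    unfolding E_def by (intro continuous_intros)
  have mR: "f \<in> borel_measurable ?R" if "continuous_on UNIV f" for f :: "real \<Rightarrow> 'b::topological_space"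
    using borel_measurable_continuous_onI[OF that] by (intro measurable_restrict_space1) simp
  have iR: "integrable ?R f" if f: "continuous_on UNIV f" for f :: "real \<Rightarrow> complex"
  proof -
    have "compact (f ` {0..T})"
      using f by (intro compact_continuous_image) (auto intro: continuous_on_subset)
    then obtain M where "\<And>s. s \<in> {0..T} \<Longrightarrow> cmod (f s) \<le> M"
      using compact_imp_bounded bounded_iff by (metis imageI)
    then show ?thesis
      using mR[OF f] by (intro R.integrable_const_bound[where B = M] AE_I2) (auto simp: space_restrict_space)
  qed
  \<comment> \<open>Each frequency of the control contributes exactly minus the free evolution of
    the initial datum at time \<open>T\<close>.\<close>
  have int: "(LINT s|?R. G z n s) = - (c n * exp (- complex_of_real (\<bar>real_of_int n\<bar> * T)) * z powi n)" for z n
  proof -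
    have abs_n: "complex_of_real \<bar>real_of_int n\<bar> = of_int \<bar>n\<bar>"
      by (metis of_int_abs of_real_of_int_eq)
    let ?e = "exp (- (\<bar>real_of_int n\<bar> * T))"
    have 1: "(LINT s|?R. complex_of_real (E n s * (a'' s - ?n2 n * a s))) =
        of_real (- (?e * (a' 0 - \<bar>real_of_int n\<bar> * a 0)))"
      unfolding E_def integral_complex_of_real
      by (intro arg_cong[where f = of_real] half_heat_time_integral da cn vT) (use T in auto)
    have 2: "(LINT s|?R. complex_of_real (E n s * (b'' s - ?n2 n * b s))) =
        of_real (- (?e * (b' 0 - \<bar>real_of_int n\<bar> * b 0)))"
      unfolding E_def integral_complex_of_real
      by (intro arg_cong[where f = of_real] half_heat_time_integral db cn vT) (use T in auto)
    have "(LINT s|?R. G z n s) =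
        (LINT s|?R. fourier_coeff w\<^sub>0 n * z powi n * of_real (E n s * (a'' s - ?n2 n * a s))) +
        (LINT s|?R. fourier_coeff w\<^sub>1 n * z powi n * of_real (E n s * (b'' s - ?n2 n * b s)))"
      unfolding G_def by (intro Bochner_Integration.integral_add iR continuous_intros cE cn)
    also have "\<dots> = fourier_coeff w\<^sub>0 n * z powi n * of_real (- (?e * (a' 0 - \<bar>real_of_int n\<bar> * a 0))) +
        fourier_coeff w\<^sub>1 n * z powi n * of_real (- (?e * (b' 0 - \<bar>real_of_int n\<bar> * b 0)))"
      by (simp only: integral_mult_right_zero 1 2)
    also have "\<dots> = - (c n * of_real ?e * z powi n)"
      by (simp add: v0 c_def steered_coeff_def algebra_simps abs_n)
    also have "of_real ?e = exp (- complex_of_real (\<bar>real_of_int n\<bar> * T))"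
      by (simp only: of_real_minus[symmetric] exp_of_real)
    finally show ?thesis .
  qed
  have sol: "half_heat_solution \<omega> (fourier_series c) u T z = 0" if z: "cmod z = 1" for z
  proof -
    have "(LINT s:{0..T}|lborel. half_heat_semigroup (T - s) (\<lambda>w. if w \<in> \<omega> then u (s, w) else 0) z) =
        (LINT s|?R. half_heat_semigroup (T - s) (\<lambda>w. if w \<in> \<omega> then u (s, w) else 0) z)"
      unfolding set_lebesgue_integral_def by (rule integral_restrict_space[symmetric]) simp
    also have "\<dots> = (LINT s|?R. (\<Sum>\<^sub>\<infinity>n. G z n s))"
      by (intro Bochner_Integration.integral_cong refl) (simp add: semi space_restrict_space)
    also have "\<dots> = (\<Sum>\<^sub>\<infinity>n. (LINT s|?R. G z n s))"
    proof (rule R.integral_infsum_int[OF _ _ D])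
      show "G z n \<in> borel_measurable ?R" for n
        unfolding G_def by (intro mR continuous_intros cE cn)
      show "norm (G z n s) \<le> D n" if "s \<in> space ?R" for n s
        using that z by (intro GD) (auto simp: space_restrict_space)
    qed
    also have "\<dots> = - half_heat_semigroup T (fourier_series c) z"
      using T by (simp only: int half_heat_semigroup_def fc infsum_uminus) simp
    finally show ?thesis by (simp add: half_heat_solution_def)
  qed
  have "AE z in circle_measure. half_heat_solution \<omega> (fourier_series c) u T z = 0"
    by (rule AE_I2) (use sol in simp)
  then show "fourier_series (steered_coeff w\<^sub>0 w\<^sub>1) \<in> null_controllable_L2 \<omega> T \<inter> sobolev k"
    using L2 sob uL2 unfolding null_controllable_L2_def c_def by blast
qed

section \<open>Approximation of positive frequencies\<close>

text \<open>The real part of the integrand is nonnegative on the support of the bump and positive at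
  \<open>z = 1\<close>. The lemma serves to guarantee coefficients that can be divided by.\<close>

lemma Re_fourier_coeff_bump_pos:
  assumes c: "c < 1" and pos: "\<And>z. cmod z = 1 \<Longrightarrow> c < Re z \<Longrightarrow> 0 \<le> Re (z powi m)" and p: "p \<noteq> 0"
  shows "0 < Re (fourier_coeff (bump c p) m)"
proof -
  define f where "f z = (max 0 (Re z - c)) ^ p * Re (z powi (- m))" for z
  have f: "continuous_on (sphere 0 1) f"
    unfolding f_def by (intro continuous_intros) auto
  have nn: "0 \<le> f z" if "cmod z = 1" for z
  proof (cases "c < Re z")
    case True
    have "Re (z powi (- m)) = Re (z powi m)"
      unfolding cnj_powi_circle[OF that, symmetric] by (simp only: cnj.sel)
    then show ?thesis using pos[OF that True] by (simp add: f_def)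
  qed (use p in \<open>simp add: f_def zero_power\<close>)
  have int: "integrable circle_measure (\<lambda>z. bump c p z * z powi (- m))"
    by (intro integrable_powi_mult integrable_circle_continuous continuous_on_bump)
  have eq: "f z = Re (bump c p z * z powi (- m))" for z by (simp add: f_def bump_def)
  have "(LINT z|circle_measure. f z) = Re (LINT z|circle_measure. bump c p z * z powi (- m))"
    unfolding eq by (rule integral_Re[OF int])
  then have Re: "Re (fourier_coeff (bump c p) m) = 1 / (2 * pi) * (LINT z|circle_measure. f z)"
    by (simp add: fourier_coeff_def)
  have "0 \<le> (LINT z|circle_measure. f z)"
    by (rule Bochner_Integration.integral_nonneg_AE, rule AE_I2) (simp add: nn)
  moreover have "(LINT z|circle_measure. f z) \<noteq> 0"
  proof
    assume "(LINT z|circle_measure. f z) = 0"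
    then have "(LINT z|circle_measure. complex_of_real (f z)) = 0" by simp
    then have "f 1 = 0" by (intro circle_integral_nonneg_eq_0[OF f nn]) auto
    then show False using c by (simp add: f_def)
  qed
  ultimately show ?thesis by (simp add: Re)
qed

section \<open>Multiplication and upper bounds on the spectrum\<close>

definition freq_le :: "int \<Rightarrow> (complex \<Rightarrow> complex) \<Rightarrow> bool" where
  "freq_le i h \<longleftrightarrow> continuous_on (sphere 0 1) h \<and> (\<forall>n>i. fourier_coeff h n = 0)"

text \<open>The spectral bound on \<open>p\<close> is expressed through multiplication by
  \<open>p\<close>, so that products and powers are handled by composition, without convolving
  coefficient sequences again.\<close>

definition freq_shift :: "int \<Rightarrow> (complex \<Rightarrow> complex) \<Rightarrow> bool" where
  "freq_shift d p \<longleftrightarrow> (\<forall>i h. freq_le i h \<longrightarrow> freq_le (i - d) (\<lambda>z. h z * p z))"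

lemma freq_shift_const: "freq_shift 0 (\<lambda>z. a)"
  using fourier_coeff_cmult[of a]
  by (auto simp: freq_shift_def freq_le_def mult.commute[of _ a] intro: continuous_intros)

lemma freq_shift_weaken: "freq_shift d p \<Longrightarrow> e \<le> d \<Longrightarrow> freq_shift e p"
  unfolding freq_shift_def freq_le_def by force

lemma freq_shift_mult:
  assumes "freq_shift d p" "freq_shift e q"
  shows "freq_shift (d + e) (\<lambda>z. p z * q z)"
  unfolding freq_shift_def
proof (intro allI impI)
  fix i h assume "freq_le i h"
  then have "freq_le (i - d) (\<lambda>z. h z * p z)" using assms(1) by (auto simp: freq_shift_def)
  then have "freq_le (i - d - e) (\<lambda>z. h z * p z * q z)" using assms(2) by (auto simp: freq_shift_def)
  then show "freq_le (i - (d + e)) (\<lambda>z. h z * (p z * q z))" by (simp add: mult.assoc diff_diff_eq)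
qed

lemma freq_shift_add:
  assumes "freq_shift d p" "freq_shift d q"
  shows "freq_shift d (\<lambda>z. p z + q z)"
  unfolding freq_shift_def
proof (intro allI impI)
  fix i h assume "freq_le i h"
  then have "freq_le (i - d) (\<lambda>z. h z * p z)" "freq_le (i - d) (\<lambda>z. h z * q z)"
    using assms by (auto simp: freq_shift_def)
  then show "freq_le (i - d) (\<lambda>z. h z * (p z + q z))"
    by (simp add: freq_le_def distrib_left fourier_coeff_add integrable_circle_continuous continuous_on_add)
qed

lemma freq_shift_power: "freq_shift d p \<Longrightarrow> freq_shift (int k * d) (\<lambda>z. p z ^ k)"
proof (induction k)
  case 0
  then show ?case using freq_shift_const[of 1] by simp
next
  case (Suc k)
  then show ?case
    using freq_shift_mult[of d p "int k * d" "\<lambda>z. p z ^ k"] by (simp add: algebra_simps)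
qed

lemma freq_shift_sum:
  "(\<And>j. j < N \<Longrightarrow> freq_shift 0 (p j)) \<Longrightarrow> freq_shift 0 (\<lambda>z. \<Sum>j<N::nat. p j z)"
proof (induction N)
  case 0
  then show ?case using freq_shift_const[of 0] by simp
next
  case (Suc N)
  then show ?case by (simp add: freq_shift_add)
qed

text \<open>In the convolution at an index \<open>m > i - 1\<close>, a frequency
  \<open>n < 0\<close> of \<open>h\<close> meets the index \<open>m - n > i\<close>, where
  \<open>g\<close> has no coefficient.\<close>

lemma freq_shift_negative_series:
  assumes h: "continuous_on (sphere 0 1) h" and s: "(\<lambda>n. cmod (fourier_coeff h n)) summable_on UNIV"
    and neg: "\<And>n. n \<ge> 0 \<Longrightarrow> fourier_coeff h n = 0"
  shows "freq_shift 1 h"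
  unfolding freq_shift_def
proof (intro allI impI)
  fix i g assume g: "freq_le i g"
  have "fourier_coeff (\<lambda>z. g z * h z) m = 0" if "m > i - 1" for m
  proof -
    have "fourier_coeff (\<lambda>z. g z * h z) m = fourier_coeff (\<lambda>z. g z * fourier_series (fourier_coeff h) z) m"
      by (intro fourier_coeff_cong) (simp add: fourier_inversion[OF h s])
    also have "\<dots> = (\<Sum>\<^sub>\<infinity>n. fourier_coeff h n * fourier_coeff g (m - n))"
      using g s by (intro fourier_coeff_fourier_series_mult) (auto simp: freq_le_def)
    also have "\<dots> = 0"
    proof (rule infsum_0)
      fix n
      show "fourier_coeff h n * fourier_coeff g (m - n) = 0"
        using neg[of n] g that by (cases "n \<ge> 0") (auto simp: freq_le_def)
    qed
    finally show ?thesis .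
  qed
  moreover have "continuous_on (sphere 0 1) (\<lambda>z. g z * h z)"
    using g h by (auto simp: freq_le_def intro: continuous_intros)
  ultimately show "freq_le (i - 1) (\<lambda>z. g z * h z)" by (auto simp: freq_le_def)
qed

text \<open>
  Split a bump \<open>\<gamma> = G + H\<close> into its frequencies \<open>\<ge> 0\<close> and \<open>< 0\<close>. Then \<open>Re G\<close> is bounded below by a
  positive constant, so \<open>1 - (1 - G / R) ^ N\<close> tends uniformly to \<open>1\<close> for large \<open>R\<close>, while the same
  polynomial in \<open>- H\<close> has only negative frequencies. Both coincide wherever \<open>\<gamma>\<close> vanishes.
\<close>
lemma one_sided_approximation:
  fixes m :: nat
  assumes w: "cmod w = 1" and c: "c < 1" and \<epsilon>: "\<epsilon> > 0"
  obtains \<Phi> where "continuous_on (sphere 0 1) \<Phi>"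
    and "\<And>z. cmod z = 1 \<Longrightarrow> Re (z * cnj w) \<le> c \<Longrightarrow> \<Phi> z = 0"
    and "\<And>n. n \<ge> 0 \<Longrightarrow> cmod (fourier_coeff \<Phi> n - (if n = int m then 1 else 0)) \<le> \<epsilon>"
proof -
  define \<gamma> where "\<gamma> z = bump c 3 (z * cnj w)" for z
  have \<gamma>: "continuous_on (sphere 0 1) \<gamma>"
    unfolding \<gamma>_def by (intro continuous_on_compose2[OF continuous_on_bump[of UNIV]] continuous_intros) auto
  define a where "a = fourier_coeff \<gamma>"
  have a: "a n = w powi (- n) * fourier_coeff (bump c 3) n" for n
    unfolding a_def \<gamma>_def by (rule fourier_coeff_rotate[OF continuous_on_bump w])
  obtain C where "\<forall>n. (1 + (real_of_int n)\<^sup>2) ^ 1 * cmod (fourier_coeff (bump c 3) n) \<le> C"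
    using fourier_coeff_bump_decay[of 1 3 c] by auto
  then have sa: "(\<lambda>n. cmod (a n)) summable_on UNIV"
    by (intro summable_on_decay_int[of _ C]) (simp add: a norm_mult cmod_powi_circle w)
  define A where "A = Re (a 0)"
  have A: "A > 0"
    unfolding A_def a using Re_fourier_coeff_bump_pos[of c 0 3] c by simp
  have ra: "a (- n) = cnj (a n)" for n
  proof -
    have "cnj (\<gamma> z) = \<gamma> z" for z by (simp add: \<gamma>_def bump_def)
    then show ?thesis using fourier_coeff_cnj[of \<gamma> "- n"] by (simp add: a_def)
  qed
  have a0: "a 0 = of_real A"
    using ra[of 0] by (simp add: A_def complex_eq_iff)

  define G where "G = fourier_series (\<lambda>n. if n \<ge> 0 then a n else 0)"
  have s: "(\<lambda>n. cmod (if n \<ge> 0 then a n else 0)) summable_on UNIV"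
    by (rule summable_on_comparison_test[OF sa]) auto
  have G: "continuous_on (sphere 0 1) G"
    unfolding G_def by (rule continuous_on_fourier_series[OF s])
  have fG: "fourier_coeff G n = (if n \<ge> 0 then a n else 0)" for n
    unfolding G_def by (rule fourier_coeff_fourier_series[OF s])
  define H where "H z = \<gamma> z - G z" for z
  have H: "continuous_on (sphere 0 1) H"
    unfolding H_def by (intro continuous_intros \<gamma> G)
  have fH: "fourier_coeff H n = (if n \<ge> 0 then 0 else a n)" for n
    unfolding H_def by (simp add: fourier_coeff_diff integrable_circle_continuous \<gamma> G fG a_def)
  have ReG: "A / 2 \<le> Re (G z)" if z: "cmod z = 1" for z
  proof -
    \<comment> \<open>\<gamma> is real, so its negative frequencies are the conjugates of the
      positive ones: \<open>H = cnj G - A\<close>. Taking real parts gives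
      \<open>Re \<gamma> = 2 * Re G - A\<close>, and \<gamma> is nonnegative.\<close>
    have "H z - (cnj (G z) - of_real A) = 0"
    proof (rule fourier_coeff_eq_0_imp_eq_0[OF _ _ z])
      show "continuous_on (sphere 0 1) (\<lambda>z. H z - (cnj (G z) - of_real A))"
        by (intro continuous_intros H G)
      fix n
      have "fourier_coeff (\<lambda>z. of_real A) n = (if n = 0 then of_real A else 0)"
        using fourier_coeff_cmult[of "of_real A" "\<lambda>z. 1" n] fourier_coeff_powi[of 0 n] by simp
      then have "fourier_coeff (\<lambda>z. cnj (G z) - of_real A) n = cnj (fourier_coeff G (- n)) - (if n = 0 then of_real A else 0)"
        by (subst fourier_coeff_diff) (auto intro!: integrable_circle_continuous continuous_intros G simp: fourier_coeff_cnj)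
      moreover have "fourier_coeff (\<lambda>z. H z - (cnj (G z) - of_real A)) n = fourier_coeff H n - fourier_coeff (\<lambda>z. cnj (G z) - of_real A) n"
        by (intro fourier_coeff_diff integrable_circle_continuous continuous_intros H G)
      ultimately show "fourier_coeff (\<lambda>z. H z - (cnj (G z) - of_real A)) n = 0"
        by (auto simp: fH fG ra a0)
    qed
    then have "Re (\<gamma> z) = 2 * Re (G z) - A"
      by (simp add: H_def complex_eq_iff)
    moreover have "0 \<le> Re (\<gamma> z)" by (simp add: \<gamma>_def bump_def)
    ultimately show ?thesis by simp
  qed
  obtain B0 where B0: "\<And>z. cmod z = 1 \<Longrightarrow> cmod (G z) \<le> B0"
    using continuous_bounded_circle[OF G] by blast
  define B where "B = max 1 B0"
  have B: "B > 0" "\<And>z. cmod z = 1 \<Longrightarrow> cmod (G z) \<le> B"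
    using B0 by (fastforce simp: B_def)+
  \<comment> \<open>This \<open>R\<close> minimises
    \<open>1 - A / R + B\<^sup>2 / R\<^sup>2\<close>, the upper bound for the square of
    \<open>cmod (1 - G z / of_real R)\<close>; the minimum is the square of
    \<open>q\<close>.\<close>
  define R where "R = 2 * B\<^sup>2 / A"
  define q where "q = sqrt (1 - A\<^sup>2 / (4 * B\<^sup>2))"
  have R: "R > 0" using A B by (simp add: R_def)
  have q: "cmod (1 - G z / of_real R) \<le> q" if z: "cmod z = 1" for z
  proof -
    have "(cmod (1 - G z / of_real R))\<^sup>2 = 1 - 2 * Re (G z) / R + (cmod (G z))\<^sup>2 / R\<^sup>2"
      unfolding cmod_power2 using R by (simp add: Re_divide_of_real Im_divide_of_real power2_eq_square field_simps)
    also have "\<dots> \<le> 1 - A / R + B\<^sup>2 / R\<^sup>2"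
      using R ReG[OF z] B(2)[OF z]
      by (intro add_mono diff_mono divide_right_mono power_mono) auto
    also have "\<dots> = 1 - A\<^sup>2 / (4 * B\<^sup>2)"
      using A B by (simp add: R_def field_simps power2_eq_square)
    finally show ?thesis unfolding q_def by (rule real_le_rsqrt)
  qed
  have q1: "0 \<le> q" "q < 1"
    using order_trans[OF norm_ge_zero q[of 1]] A B by (auto simp: q_def)

  have "isCont (\<lambda>x::complex. (1 - x) ^ Suc m) 0" by (intro continuous_intros)
  then obtain \<eta> where \<eta>: "\<eta> > 0" "\<And>x::complex. cmod x < \<eta> \<Longrightarrow> cmod ((1 - x) ^ Suc m - 1) < \<epsilon>"
    using \<epsilon> by (auto simp: continuous_at_eps_delta dist_norm)
  obtain N where N: "q ^ N < \<eta>" using real_arch_pow_inv[OF \<eta>(1) q1(2)] by blast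

  \<comment> \<open>The power \<open>m + 1\<close> outweighs the factor \<open>z ^ m\<close>:
    \<open>1 - (1 + H / R) ^ N\<close> has frequencies at most -1, so \<open>F2\<close> ends at
    \<open>m - (m + 1) = -1\<close>. Near the value 1 the power does no harm, so \<open>F1\<close>
    stays close to \<open>z ^ m\<close>.\<close>
  define F where "F x z = z powi int m * (1 - x z ^ N) ^ Suc m" for x :: "complex \<Rightarrow> complex" and z
  define F1 where "F1 = F (\<lambda>z. 1 - G z / of_real R)"
  define F2 where "F2 = F (\<lambda>z. 1 + H z / of_real R)"
  have c1: "continuous_on (sphere 0 1) F1"
    unfolding F1_def F_def by (intro continuous_intros continuous_on_circle_powi G) (use R in auto)
  have c2: "continuous_on (sphere 0 1) F2"
    unfolding F2_def F_def by (intro continuous_intros continuous_on_circle_powi H) (use R in auto)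
  have F2: "fourier_coeff F2 n = 0" if n: "n \<ge> 0" for n
  proof -
    have "(\<lambda>n. cmod (fourier_coeff H n)) summable_on UNIV"
      by (rule summable_on_comparison_test[OF sa]) (auto simp: fH)
    then have sH: "freq_shift 1 H"
      by (intro freq_shift_negative_series H) (auto simp: fH)
    have sH': "freq_shift 1 (\<lambda>z. b * H z)" for b
      using freq_shift_mult[OF freq_shift_const sH] by simp
    have "freq_shift 0 (\<lambda>z. 1 + (1 / of_real R) * H z)"
      by (intro freq_shift_add freq_shift_const freq_shift_weaken[OF sH']) simp
    from freq_shift_power[OF this]
    have "freq_shift 0 (\<lambda>z. \<Sum>j<N. (1 + (1 / of_real R) * H z) ^ j)"
      by (intro freq_shift_sum) simp
    from freq_shift_mult[OF sH'[of "- 1 / of_real R"] this]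
    \<comment> \<open>Factoring \<open>1 - x ^ N\<close> by the geometric sum exposes one factor
      \<open>H\<close>, which lowers the spectrum by 1; the sum does not raise it.\<close>
    have "freq_shift 1 (\<lambda>z. (- 1 / of_real R) * H z * (\<Sum>j<N. (1 + (1 / of_real R) * H z) ^ j))"
      by (simp only: add_0_right)
    also have "(\<lambda>z. (- 1 / of_real R) * H z * (\<Sum>j<N. (1 + (1 / of_real R) * H z) ^ j)) =
        (\<lambda>z. 1 - (1 + H z / of_real R) ^ N)"
      by (simp add: one_diff_power_eq)
    finally have "freq_shift (int (Suc m)) (\<lambda>z. (1 - (1 + H z / of_real R) ^ N) ^ Suc m)"
      using freq_shift_power[of 1 _ "Suc m"] by simp
    moreover have "freq_le 0 (\<lambda>z. 1)"
      using fourier_coeff_powi[of 0] by (simp add: freq_le_def)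
    ultimately have "freq_le (- int (Suc m)) (\<lambda>z. (1 - (1 + H z / of_real R) ^ N) ^ Suc m)"
      unfolding freq_shift_def by (metis (no_types, lifting) diff_0 mult_1 ext)
    then show ?thesis
      using n by (simp add: F2_def F_def[abs_def] fourier_coeff_powi_mult freq_le_def del: power_int_of_nat power_Suc)
  qed
  have F1: "cmod (fourier_coeff F1 n - (if n = int m then 1 else 0)) \<le> \<epsilon>" for n
  proof -
    have "fourier_coeff F1 n - (if n = int m then 1 else 0) = fourier_coeff (\<lambda>z. F1 z - z powi int m) n"
      by (simp only: fourier_coeff_diff integrable_circle_continuous c1 continuous_on_circle_powi fourier_coeff_powi)
    also have "cmod \<dots> \<le> \<epsilon>"
    proof (rule cmod_fourier_coeff_le)
      show "(\<lambda>z. F1 z - z powi int m) \<in> borel_measurable circle_measure"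
        by (intro borel_measurable_circleI continuous_on_diff c1 continuous_on_circle_powi)
      fix z :: complex assume z: "cmod z = 1"
      have "cmod ((1 - G z / of_real R) ^ N) \<le> q ^ N"
        unfolding norm_power using q[OF z] by (intro power_mono) auto
      then have "cmod ((1 - (1 - G z / of_real R) ^ N) ^ Suc m - 1) \<le> \<epsilon>"
        using N by (intro less_imp_le \<eta>(2)) simp
      moreover have "F1 z - z powi int m = z powi int m * ((1 - (1 - G z / of_real R) ^ N) ^ Suc m - 1)"
        unfolding F1_def F_def right_diff_distrib mult_1_right ..
      ultimately show "cmod (F1 z - z powi int m) \<le> \<epsilon>"
        by (simp only: norm_mult cmod_powi_circle[OF z] mult_1)
    qed
    finally show ?thesis .
  qed
  show ?thesis
  proof (rule that[of "\<lambda>z. F1 z - F2 z"])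
    show "continuous_on (sphere 0 1) (\<lambda>z. F1 z - F2 z)"
      by (intro continuous_on_diff c1 c2)
    show "F1 z - F2 z = 0" if "cmod z = 1" "Re (z * cnj w) \<le> c" for z
    proof -
      \<comment> \<open>Here \<open>H z = - G z\<close>, so \<open>F1\<close> and \<open>F2\<close>
        evaluate the same polynomial at the same point.\<close>
      have "\<gamma> z = 0" using that(2) by (simp add: \<gamma>_def bump_def)
      then show ?thesis by (simp add: F1_def F2_def F_def H_def)
    qed
    show "cmod (fourier_coeff (\<lambda>z. F1 z - F2 z) n - (if n = int m then 1 else 0)) \<le> \<epsilon>" if "n \<ge> 0" for n
      using F1[of n] F2[OF that] by (simp add: fourier_coeff_diff integrable_circle_continuous c1 c2)
  qed
qed

section \<open>Density\<close>

lemma circle_cap_cis: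
  assumes z: "cmod z = 1" and h: "0 \<le> h" "h \<le> pi" and c: "cos h < Re z"
  obtains t where "\<bar>t\<bar> < h" "z = cis t"
proof -
  have "z \<noteq> 0" using z by auto
  then have zt: "z = cis (Arg z)" using z cis_Arg[of z] by (simp add: sgn_eq)
  have "\<bar>Arg z\<bar> \<le> pi" using Arg_bounded[of z] by auto
  moreover have "cos h < cos \<bar>Arg z\<bar>" using c zt by (metis cis.sel(1) cos_abs_real)
  ultimately have "\<bar>Arg z\<bar> < h"
    using h cos_mono_less_eq[of h "\<bar>Arg z\<bar>"] by simp
  then show ?thesis using zt by (rule that)
qed

text \<open>Angular distances to 1 add up under multiplication; the bound by \<open>pi\<close> keeps
  the cosine monotone.\<close>

lemma circle_cap_mult:
  assumes u: "cmod u = 1" "cos h1 < Re u" and v: "cmod v = 1" "cos h2 < Re v"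
    and h: "0 \<le> h1" "0 \<le> h2" "h1 + h2 \<le> h" "h \<le> pi"
  shows "cos h < Re (u * v)"
proof -
  obtain s where s: "\<bar>s\<bar> < h1" "u = cis s" using circle_cap_cis[of u h1] u h by auto
  obtain t where t: "\<bar>t\<bar> < h2" "v = cis t" using circle_cap_cis[of v h2] v h by auto
  have "cos h < cos \<bar>s + t\<bar>"
    using s(1) t(1) h by (subst cos_mono_less_eq) auto
  then show ?thesis by (simp add: s t cis_mult)
qed

text \<open>\<open>w\<close> is the midpoint and \<open>h\<close> half the length of the arc.
  Strictness gives \<open>h < pi\<close>, so the arc is exactly a cap
  \<open>cos h < Re (z * cnj w)\<close>, a form suited to the bumps.\<close>

lemma open_strict_arc_cap:
  assumes "open_strict_arc \<omega>"
  obtains w h where "cmod w = 1" "0 < h" "h < pi" "\<omega> \<in> sets circle_measure"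
    "\<And>z. cmod z = 1 \<Longrightarrow> cos h < Re (z * cnj w) \<Longrightarrow> z \<in> \<omega>"
proof -
  obtain a b where ab: "0 < b - a" "b - a < 2 * pi" and \<omega>: "\<omega> = cis ` {a<..<b}"
    using assms by (auto simp: open_strict_arc_def)
  define w where "w = cis ((a + b) / 2)"
  define h where "h = (b - a) / 2"
  have h: "0 < h" "h < pi" using ab by (auto simp: h_def)
  have sub: "z \<in> \<omega>" if z: "cmod z = 1" "cos h < Re (z * cnj w)" for z
  proof -
    obtain t where t: "\<bar>t\<bar> < h" "z * cnj w = cis t"
      using circle_cap_cis[of "z * cnj w" h] z h by (auto simp: norm_mult w_def)
    have "z = (z * cnj w) * w" by (simp add: w_def mult.assoc cis_cnj cis_mult)
    also have "\<dots> = cis (t + (a + b) / 2)" unfolding t(2) by (simp add: w_def cis_mult)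
    finally have "z = cis (t + (a + b) / 2)" .
    moreover have "t + (a + b) / 2 \<in> {a<..<b}" using t(1) by (auto simp: h_def field_simps abs_less_iff)
    ultimately show ?thesis unfolding \<omega> by blast
  qed
  have "\<omega> = {z. cos h < Re (z * cnj w)} \<inter> sphere 0 1"
  proof (intro equalityI subsetI)
    fix z assume "z \<in> \<omega>"
    then obtain y where y: "a < y" "y < b" "z = cis y" by (auto simp: \<omega>)
    have "cos h < cos \<bar>y - (a + b) / 2\<bar>"
      using y(1,2) h by (subst cos_mono_less_eq) (auto simp: h_def abs_if field_simps)
    moreover have zw: "z * cnj w = cis (y - (a + b) / 2)"
      by (simp only: y w_def cis_cnj cis_mult) simp
    ultimately have "cos h < Re (z * cnj w)"
      unfolding zw by simp
    then show "z \<in> {z. cos h < Re (z * cnj w)} \<inter> sphere 0 1"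
      using y(3) by (intro IntI CollectI) simp_all
  next
    fix z assume "z \<in> {z. cos h < Re (z * cnj w)} \<inter> sphere 0 1"
    then show "z \<in> \<omega>" using sub by auto
  qed
  moreover have "open {z. cos h < Re (z * cnj w)}"
    by (intro open_Collect_less continuous_intros)
  ultimately have "\<omega> \<in> sets circle_measure"
    unfolding sets_circle_measure sets_restrict_space by auto
  then show ?thesis
    by (intro that[of w h] h sub) (auto simp: w_def)
qed

text \<open>\<Phi> and the kernels each extend over at most half of the angular radius
  \<open>h\<close>, so the convolution stays inside the cap. Decay and derivatives come from
  \<kappa>; \<Phi> contributes only bounded coefficients.\<close>

lemma angular_pair_circle_conv:
  assumes arc: "\<And>z. cmod z = 1 \<Longrightarrow> cos h < Re (z * cnj w) \<Longrightarrow> z \<in> \<omega>"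
    and w: "cmod w = 1" and h: "h \<le> pi" "0 \<le> \<delta>" "\<delta> \<le> h / 2"
    and \<Phi>: "continuous_on (sphere 0 1) \<Phi>"
    and \<Phi>0: "\<And>z. cmod z = 1 \<Longrightarrow> Re (z * cnj w) \<le> cos (h / 2) \<Longrightarrow> \<Phi> z = 0"
    and \<kappa>: "continuous_on UNIV \<kappa>" "continuous_on UNIV \<kappa>2"
    and \<kappa>0: "\<And>z. Re z \<le> cos \<delta> \<Longrightarrow> \<kappa> z = 0" "\<And>z. Re z \<le> cos \<delta> \<Longrightarrow> \<kappa>2 z = 0"
    and \<kappa>2: "\<And>n. fourier_coeff \<kappa>2 n = - of_int (n\<^sup>2) * fourier_coeff \<kappa> n"
    and C: "\<And>n. (1 + (real_of_int n)\<^sup>2) ^ Suc (Suc k) * cmod (fourier_coeff \<kappa> n) \<le> C"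
  shows "angular_pair \<omega> k (circle_conv \<Phi> \<kappa>) (circle_conv \<Phi> \<kappa>2)"
proof -
  have m: "\<Phi> \<in> borel_measurable circle_measure" by (rule borel_measurable_circleI[OF \<Phi>])
  obtain A where A: "\<And>z. cmod z = 1 \<Longrightarrow> cmod (\<Phi> z) \<le> A"
    using continuous_bounded_circle[OF \<Phi>] by blast
  have A0: "A \<ge> 0" using A[of 1] by (auto intro: order_trans[OF norm_ge_zero])
  have "continuous_on (sphere 0 1) \<kappa>" "continuous_on (sphere 0 1) \<kappa>2"
    using \<kappa> by (auto intro: continuous_on_subset)
  then obtain B B2 where B: "\<And>z. cmod z = 1 \<Longrightarrow> cmod (\<kappa> z) \<le> B" "\<And>z. cmod z = 1 \<Longrightarrow> cmod (\<kappa>2 z) \<le> B2"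
    using continuous_bounded_circle by metis
  have bd: "cmod (circle_conv \<Phi> \<kappa> z) \<le> max (A * B) (A * B2) \<and> cmod (circle_conv \<Phi> \<kappa>2 z) \<le> max (A * B) (A * B2)"
    if "cmod z = 1" for z
    using cmod_circle_conv_le[OF m A \<kappa>(1) B(1) that] cmod_circle_conv_le[OF m A \<kappa>(2) B(2) that] by auto
  have supp: "circle_conv \<Phi> f z = 0"
    if z: "cmod z = 1" "z \<notin> \<omega>" and f: "\<And>z. Re z \<le> cos \<delta> \<Longrightarrow> f z = 0" for f z
  proof (rule circle_conv_eq_0, rule ccontr)
    fix x assume x: "cmod x = 1" and n0: "\<Phi> x * f (z * cnj x) \<noteq> 0"
    have 1: "cos (h / 2) < Re (x * cnj w)" using \<Phi>0[OF x] n0 by fastforce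
    have 2: "cos \<delta> < Re (z * cnj x)" using f[of "z * cnj x"] n0 by fastforce
    have "cos h < Re ((z * cnj x) * (x * cnj w))"
      using h by (intro circle_cap_mult[OF _ 2 _ 1]) (auto simp: norm_mult z x w)
    also have "(z * cnj x) * (x * cnj w) = z * cnj w * (x * cnj x)" by simp
    also have "x * cnj x = 1" using x by (metis complex_norm_square of_real_1 one_power2)
    finally show False using arc[OF z(1)] z(2) by simp
  qed
  have dec: "(1 + (real_of_int n)\<^sup>2) ^ Suc (Suc k) * cmod (fourier_coeff (circle_conv \<Phi> \<kappa>) n) \<le> A * C" for n
  proof -
    have "(1 + (real_of_int n)\<^sup>2) ^ Suc (Suc k) * cmod (fourier_coeff (circle_conv \<Phi> \<kappa>) n) =
        cmod (fourier_coeff \<Phi> n) * ((1 + (real_of_int n)\<^sup>2) ^ Suc (Suc k) * cmod (fourier_coeff \<kappa> n))"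
      by (simp only: fourier_coeff_circle_conv[OF m A \<kappa>(1)] norm_mult mult_ac)
    also have "\<dots> \<le> A * C"
      by (intro mult_mono cmod_fourier_coeff_le[OF m A] C A0) auto
    finally show ?thesis .
  qed
  show ?thesis
    unfolding angular_pair_def
  proof (intro conjI)
    show "\<exists>B. \<forall>z. cmod z = 1 \<longrightarrow> cmod (circle_conv \<Phi> \<kappa> z) \<le> B \<and> cmod (circle_conv \<Phi> \<kappa>2 z) \<le> B"
      using bd by blast
    show "\<forall>z. cmod z = 1 \<and> z \<notin> \<omega> \<longrightarrow> circle_conv \<Phi> \<kappa> z = 0 \<and> circle_conv \<Phi> \<kappa>2 z = 0"
      using supp \<kappa>0 by blast
    show "\<forall>n. fourier_coeff (circle_conv \<Phi> \<kappa>2) n = - of_int (n\<^sup>2) * fourier_coeff (circle_conv \<Phi> \<kappa>) n"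
      by (simp add: fourier_coeff_circle_conv[OF m A] \<kappa> \<kappa>2)
    show "\<exists>C. \<forall>n. (1 + (real_of_int n)\<^sup>2) ^ Suc (Suc k) * cmod (fourier_coeff (circle_conv \<Phi> \<kappa>) n) \<le> C"
      using dec by blast
  qed (intro circle_conv_measurable m \<kappa>)+
qed

lemma angular_pair_zero: "angular_pair \<omega> k (\<lambda>z. 0) (\<lambda>z. 0)"
  by (auto simp: angular_pair_def fourier_coeff_def)

lemma angular_pair_cmult:
  assumes "angular_pair \<omega> k w v"
  shows "angular_pair \<omega> k (\<lambda>z. a * w z) (\<lambda>z. a * v z)"
proof -
  obtain B C where B: "\<And>z. cmod z = 1 \<Longrightarrow> cmod (w z) \<le> B \<and> cmod (v z) \<le> B"
    and C: "\<And>n. (1 + (real_of_int n)\<^sup>2) ^ Suc (Suc k) * cmod (fourier_coeff w n) \<le> C"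
    using assms unfolding angular_pair_def by metis
  have "\<forall>z. cmod z = 1 \<longrightarrow> cmod (a * w z) \<le> cmod a * B \<and> cmod (a * v z) \<le> cmod a * B"
    using B by (auto simp: norm_mult intro: mult_left_mono)
  moreover have "(1 + (real_of_int n)\<^sup>2) ^ Suc (Suc k) * cmod (fourier_coeff (\<lambda>z. a * w z) n) \<le> cmod a * C" for n
    using mult_left_mono[OF C[of n], of "cmod a"] by (simp add: fourier_coeff_cmult norm_mult mult_ac)
  ultimately show ?thesis
    using assms unfolding angular_pair_def by (auto simp: fourier_coeff_cmult)
qed

lemma angular_pair_add:
  assumes 1: "angular_pair \<omega> k w v" and 2: "angular_pair \<omega> k w' v'"
  shows "angular_pair \<omega> k (\<lambda>z. w z + w' z) (\<lambda>z. v z + v' z)"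
proof -
  note int = angular_pair_integrable[OF 1] angular_pair_integrable[OF 2]
  obtain B C where B: "\<And>z. cmod z = 1 \<Longrightarrow> cmod (w z) \<le> B \<and> cmod (v z) \<le> B"
    and C: "\<And>n. (1 + (real_of_int n)\<^sup>2) ^ Suc (Suc k) * cmod (fourier_coeff w n) \<le> C"
    using 1 unfolding angular_pair_def by metis
  obtain B' C' where B': "\<And>z. cmod z = 1 \<Longrightarrow> cmod (w' z) \<le> B' \<and> cmod (v' z) \<le> B'"
    and C': "\<And>n. (1 + (real_of_int n)\<^sup>2) ^ Suc (Suc k) * cmod (fourier_coeff w' n) \<le> C'"
    using 2 unfolding angular_pair_def by metis
  have "\<forall>z. cmod z = 1 \<longrightarrow> cmod (w z + w' z) \<le> B + B' \<and> cmod (v z + v' z) \<le> B + B'"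
    using B B' by (auto intro: norm_triangle_mono)
  moreover have "(1 + (real_of_int n)\<^sup>2) ^ Suc (Suc k) * cmod (fourier_coeff (\<lambda>z. w z + w' z) n) \<le> C + C'" for n
  proof -
    have "(1 + (real_of_int n)\<^sup>2) ^ Suc (Suc k) * cmod (fourier_coeff w n + fourier_coeff w' n) \<le>
      (1 + (real_of_int n)\<^sup>2) ^ Suc (Suc k) * (cmod (fourier_coeff w n) + cmod (fourier_coeff w' n))"
      by (intro mult_left_mono norm_triangle_ineq) auto
    then show ?thesis using C[of n] C'[of n] by (simp add: fourier_coeff_add int distrib_left)
  qed
  ultimately show ?thesis
    using 1 2 int unfolding angular_pair_def by (auto simp: fourier_coeff_add distrib_left)
qed

lemma angular_pair_cnj:
  assumes "angular_pair \<omega> k w v"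
  shows "angular_pair \<omega> k (\<lambda>z. cnj (w z)) (\<lambda>z. cnj (v z))"
proof -
  obtain C where C: "\<And>n. (1 + (real_of_int n)\<^sup>2) ^ Suc (Suc k) * cmod (fourier_coeff w n) \<le> C"
    using assms unfolding angular_pair_def by metis
  have "(1 + (real_of_int n)\<^sup>2) ^ Suc (Suc k) * cmod (fourier_coeff (\<lambda>z. cnj (w z)) n) \<le> C" for n
    using C[of "- n"] by (simp add: fourier_coeff_cnj)
  moreover have "(\<lambda>z. cnj (f z)) \<in> borel_measurable circle_measure"
    if "f \<in> borel_measurable circle_measure" for f
    by (rule measurable_compose[OF that borel_measurable_continuous_onI]) (intro continuous_intros)
  ultimately show ?thesis
    using assms unfolding angular_pair_def fourier_coeff_cnj by simp blast
qed

section \<open>The space of coefficient sequences of steered data\<close>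

definition steered :: "complex set \<Rightarrow> nat \<Rightarrow> (int \<Rightarrow> complex) set" where
  "steered \<omega> k = {steered_coeff w\<^sub>0 w\<^sub>1 | w\<^sub>0 v\<^sub>0 w\<^sub>1 v\<^sub>1. angular_pair \<omega> k w\<^sub>0 v\<^sub>0 \<and> angular_pair \<omega> k w\<^sub>1 v\<^sub>1}"

lemma steered_zero: "(\<lambda>n. 0) \<in> steered \<omega> k"
proof -
  have "(\<lambda>n. 0) = steered_coeff (\<lambda>z. 0) (\<lambda>z. 0)" by (auto simp: steered_coeff_def fourier_coeff_def)
  then show ?thesis unfolding steered_def using angular_pair_zero by blast
qed

lemma steered_add:
  assumes "a \<in> steered \<omega> k" "b \<in> steered \<omega> k"
  shows "(\<lambda>n. a n + b n) \<in> steered \<omega> k"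
proof -
  obtain w0 v0 w1 v1 where a: "a = steered_coeff w0 w1" and p: "angular_pair \<omega> k w0 v0" "angular_pair \<omega> k w1 v1"
    using assms by (auto simp: steered_def)
  obtain w0' v0' w1' v1' where b: "b = steered_coeff w0' w1'" and p': "angular_pair \<omega> k w0' v0'" "angular_pair \<omega> k w1' v1'"
    using assms by (auto simp: steered_def)
  have "(\<lambda>n. a n + b n) = steered_coeff (\<lambda>z. w0 z + w0' z) (\<lambda>z. w1 z + w1' z)"
    by (simp add: fun_eq_iff a b steered_coeff_def fourier_coeff_add algebra_simps
        angular_pair_integrable[OF p(1)] angular_pair_integrable[OF p(2)]
        angular_pair_integrable[OF p'(1)] angular_pair_integrable[OF p'(2)])
  then show ?thesis unfolding steered_def using angular_pair_add p p' by blast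
qed

lemma steered_cmult:
  assumes "a \<in> steered \<omega> k"
  shows "(\<lambda>n. x * a n) \<in> steered \<omega> k"
proof -
  obtain w0 v0 w1 v1 where a: "a = steered_coeff w0 w1" and p: "angular_pair \<omega> k w0 v0" "angular_pair \<omega> k w1 v1"
    using assms by (auto simp: steered_def)
  have "(\<lambda>n. x * a n) = steered_coeff (\<lambda>z. x * w0 z) (\<lambda>z. x * w1 z)"
    by (simp add: fun_eq_iff a steered_coeff_def fourier_coeff_cmult algebra_simps)
  then show ?thesis unfolding steered_def using angular_pair_cmult p by blast
qed

text \<open>The weight \<open>\<bar>n\<bar>\<close> is even, so conjugating both functions reflects
  the sequence. This carries approximation at positive frequencies over to negative ones.\<close>

lemma steered_cnj:
  assumes "a \<in> steered \<omega> k"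
  shows "(\<lambda>n. cnj (a (- n))) \<in> steered \<omega> k"
proof -
  obtain w0 v0 w1 v1 where a: "a = steered_coeff w0 w1" and p: "angular_pair \<omega> k w0 v0" "angular_pair \<omega> k w1 v1"
    using assms by (auto simp: steered_def)
  have "(\<lambda>n. cnj (a (- n))) = steered_coeff (\<lambda>z. cnj (w0 z)) (\<lambda>z. cnj (w1 z))"
    by (simp add: fun_eq_iff a steered_coeff_def fourier_coeff_cnj)
  then show ?thesis unfolding steered_def using angular_pair_cnj p by blast
qed

lemma steered_sobolev:
  assumes "a \<in> steered \<omega> k"
  shows "sobolev_coeff k a"
proof -
  obtain w0 v0 w1 v1 where a: "a = steered_coeff w0 w1" and p: "angular_pair \<omega> k w0 v0" "angular_pair \<omega> k w1 v1"
    using assms by (auto simp: steered_def)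
  obtain C where "\<And>n. (1 + (real_of_int n)\<^sup>2) ^ Suc k * cmod (steered_coeff w0 w1 n) \<le> C"
    using steered_coeff_decay[OF p] by blast
  then show ?thesis unfolding a by (rule decay_imp_sobolev)
qed

definition sobolev_sqnorm :: "nat \<Rightarrow> (int \<Rightarrow> complex) \<Rightarrow> real" where
  "sobolev_sqnorm k a = (\<Sum>\<^sub>\<infinity>n. (1 + (real_of_int n)\<^sup>2) ^ k * (cmod (a n))\<^sup>2)"

lemma sobolev_coeff_mono:
  assumes b: "sobolev_coeff k b" and le: "\<And>n. cmod (a n) \<le> cmod (b n)"
  shows "sobolev_coeff k a" "sobolev_sqnorm k a \<le> sobolev_sqnorm k b"
proof -
  have *: "(1 + (real_of_int n)\<^sup>2) ^ k * (cmod (a n))\<^sup>2 \<le> (1 + (real_of_int n)\<^sup>2) ^ k * (cmod (b n))\<^sup>2" for n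
    by (intro mult_left_mono power_mono le) auto
  show a: "sobolev_coeff k a"
    unfolding sobolev_coeff_def
    by (rule summable_on_comparison_test[OF b[unfolded sobolev_coeff_def]]) (use * in auto)
  show "sobolev_sqnorm k a \<le> sobolev_sqnorm k b"
    unfolding sobolev_sqnorm_def
    by (rule infsum_mono) (use a b * in \<open>auto simp: sobolev_coeff_def\<close>)
qed

lemma sobolev_coeff_cmult:
  assumes "sobolev_coeff k a"
  shows "sobolev_coeff k (\<lambda>n. x * a n)" "sobolev_sqnorm k (\<lambda>n. x * a n) = (cmod x)\<^sup>2 * sobolev_sqnorm k a"
proof -
  have *: "(1 + (real_of_int n)\<^sup>2) ^ k * (cmod (x * a n))\<^sup>2 = (cmod x)\<^sup>2 * ((1 + (real_of_int n)\<^sup>2) ^ k * (cmod (a n))\<^sup>2)" for n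
    by (simp add: norm_mult power_mult_distrib)
  show "sobolev_coeff k (\<lambda>n. x * a n)"
    using assms unfolding sobolev_coeff_def * by (rule summable_on_cmult_right)
  show "sobolev_sqnorm k (\<lambda>n. x * a n) = (cmod x)\<^sup>2 * sobolev_sqnorm k a"
    unfolding sobolev_sqnorm_def * by (rule infsum_cmult_right')
qed

text \<open>The second part comes from
  \<open>(x + y)\<^sup>2 \<le> 2 * x\<^sup>2 + 2 * y\<^sup>2\<close>. It stands in for the triangle
  inequality and explains the quarters of \<epsilon> in the closure arguments.\<close>

lemma sobolev_coeff_add:
  assumes a: "sobolev_coeff k a" and b: "sobolev_coeff k b"
  shows "sobolev_coeff k (\<lambda>n. a n + b n)"
    and "sobolev_sqnorm k (\<lambda>n. a n + b n) \<le> 2 * sobolev_sqnorm k a + 2 * sobolev_sqnorm k b"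
proof -
  let ?x = "\<lambda>n. (1 + (real_of_int n)\<^sup>2) ^ k"
  have *: "?x n * (cmod (a n + b n))\<^sup>2 \<le> 2 * (?x n * (cmod (a n))\<^sup>2) + 2 * (?x n * (cmod (b n))\<^sup>2)" for n
  proof -
    have "(cmod (a n + b n))\<^sup>2 \<le> (cmod (a n) + cmod (b n))\<^sup>2"
      by (intro power_mono norm_triangle_ineq) auto
    also have "\<dots> \<le> 2 * (cmod (a n))\<^sup>2 + 2 * (cmod (b n))\<^sup>2"
      using sum_squares_bound[of "cmod (a n)" "cmod (b n)"] by (simp add: power2_sum)
    finally have "?x n * (cmod (a n + b n))\<^sup>2 \<le> ?x n * (2 * (cmod (a n))\<^sup>2 + 2 * (cmod (b n))\<^sup>2)"
      by (intro mult_left_mono) auto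
    then show ?thesis by (simp add: algebra_simps)
  qed
  have sa: "(\<lambda>n. 2 * (?x n * (cmod (a n))\<^sup>2)) summable_on UNIV" and sb: "(\<lambda>n. 2 * (?x n * (cmod (b n))\<^sup>2)) summable_on UNIV"
    using a b unfolding sobolev_coeff_def by (auto intro: summable_on_cmult_right)
  note s = summable_on_add[OF sa sb]
  show ab: "sobolev_coeff k (\<lambda>n. a n + b n)"
    unfolding sobolev_coeff_def by (rule summable_on_comparison_test[OF s]) (use * in auto)
  have "sobolev_sqnorm k (\<lambda>n. a n + b n) \<le> (\<Sum>\<^sub>\<infinity>n. 2 * (?x n * (cmod (a n))\<^sup>2) + 2 * (?x n * (cmod (b n))\<^sup>2))"
    unfolding sobolev_sqnorm_def by (rule infsum_mono) (use ab s * in \<open>auto simp: sobolev_coeff_def\<close>)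
  also have "\<dots> = 2 * sobolev_sqnorm k a + 2 * sobolev_sqnorm k b"
    unfolding sobolev_sqnorm_def by (simp add: infsum_add[OF sa sb] infsum_cmult_right')
  finally show "sobolev_sqnorm k (\<lambda>n. a n + b n) \<le> 2 * sobolev_sqnorm k a + 2 * sobolev_sqnorm k b" .
qed

lemma sobolev_coeff_cnj:
  "sobolev_coeff k (\<lambda>n. cnj (a (- n))) = sobolev_coeff k a"
  "sobolev_sqnorm k (\<lambda>n. cnj (a (- n))) = sobolev_sqnorm k a"
proof -
  have bij: "bij_betw uminus (UNIV :: int set) UNIV" by (rule bij_uminus)
  show "sobolev_coeff k (\<lambda>n. cnj (a (- n))) = sobolev_coeff k a"
    using summable_on_reindex_bij_betw[OF bij, of "\<lambda>n. (1 + (real_of_int n)\<^sup>2) ^ k * (cmod (a n))\<^sup>2"]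
    by (simp add: sobolev_coeff_def)
  show "sobolev_sqnorm k (\<lambda>n. cnj (a (- n))) = sobolev_sqnorm k a"
    using infsum_reindex_bij_betw[OF bij, of "\<lambda>n. (1 + (real_of_int n)\<^sup>2) ^ k * (cmod (a n))\<^sup>2"]
    by (simp add: sobolev_sqnorm_def)
qed

text \<open>The closure is taken among coefficient sequences, so functions are rebuilt only once, at
  the very end.\<close>

definition steered_closure :: "complex set \<Rightarrow> nat \<Rightarrow> (int \<Rightarrow> complex) set" where
  "steered_closure \<omega> k =
     {a. sobolev_coeff k a \<and> (\<forall>\<epsilon>>0. \<exists>b\<in>steered \<omega> k. sobolev_sqnorm k (\<lambda>n. a n - b n) < \<epsilon>)}"

lemma sobolev_coeff_diff:
  assumes a: "sobolev_coeff k a" and b: "sobolev_coeff k b"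
  shows "sobolev_coeff k (\<lambda>n. a n - b n)"
  using sobolev_coeff_add(1)[OF a sobolev_coeff_cmult(1)[OF b, of "-1"]] by simp

lemma steered_in_closure:
  assumes a: "a \<in> steered \<omega> k"
  shows "a \<in> steered_closure \<omega> k"
  unfolding steered_closure_def
proof (intro CollectI conjI allI impI)
  fix \<epsilon> :: real assume "\<epsilon> > 0"
  then have "sobolev_sqnorm k (\<lambda>n. a n - a n) < \<epsilon>" by (simp add: sobolev_sqnorm_def)
  with a show "\<exists>b\<in>steered \<omega> k. sobolev_sqnorm k (\<lambda>n. a n - b n) < \<epsilon>" by (intro bexI[of _ a])
qed (rule steered_sobolev[OF a])

lemma steered_closure_limit:
  assumes a: "sobolev_coeff k a"
    and lim: "\<And>\<epsilon>. \<epsilon> > 0 \<Longrightarrow> \<exists>b\<in>steered_closure \<omega> k. sobolev_sqnorm k (\<lambda>n. a n - b n) < \<epsilon>"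
  shows "a \<in> steered_closure \<omega> k"
  unfolding steered_closure_def
proof (intro CollectI conjI allI impI a)
  fix \<epsilon> :: real assume "\<epsilon> > 0"
  then have e: "\<epsilon> / 4 > 0" by simp
  obtain b where b: "b \<in> steered_closure \<omega> k" "sobolev_sqnorm k (\<lambda>n. a n - b n) < \<epsilon> / 4"
    using lim[OF e] by blast
  then obtain d where d: "d \<in> steered \<omega> k" "sobolev_sqnorm k (\<lambda>n. b n - d n) < \<epsilon> / 4"
    using e unfolding steered_closure_def by blast
  have "sobolev_sqnorm k (\<lambda>n. (a n - b n) + (b n - d n)) \<le>
     2 * sobolev_sqnorm k (\<lambda>n. a n - b n) + 2 * sobolev_sqnorm k (\<lambda>n. b n - d n)"
    using a b(1) steered_sobolev[OF d(1)]
    by (intro sobolev_coeff_add sobolev_coeff_diff) (auto simp: steered_closure_def)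
  then have "sobolev_sqnorm k (\<lambda>n. a n - d n) < \<epsilon>" using b(2) d(2) by simp
  with d(1) show "\<exists>b\<in>steered \<omega> k. sobolev_sqnorm k (\<lambda>n. a n - b n) < \<epsilon>" by blast
qed

lemma steered_closure_add:
  assumes a: "a \<in> steered_closure \<omega> k" and b: "b \<in> steered_closure \<omega> k"
  shows "(\<lambda>n. a n + b n) \<in> steered_closure \<omega> k"
  unfolding steered_closure_def
proof (intro CollectI conjI allI impI)
  show "sobolev_coeff k (\<lambda>n. a n + b n)"
    using a b by (auto simp: steered_closure_def intro: sobolev_coeff_add)
  fix \<epsilon> :: real assume "\<epsilon> > 0"
  then have e: "\<epsilon> / 4 > 0" by simp
  obtain a' where a': "a' \<in> steered \<omega> k" "sobolev_sqnorm k (\<lambda>n. a n - a' n) < \<epsilon> / 4"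
    using a e unfolding steered_closure_def by blast
  obtain b' where b': "b' \<in> steered \<omega> k" "sobolev_sqnorm k (\<lambda>n. b n - b' n) < \<epsilon> / 4"
    using b e unfolding steered_closure_def by blast
  have "sobolev_sqnorm k (\<lambda>n. (a n - a' n) + (b n - b' n)) \<le>
     2 * sobolev_sqnorm k (\<lambda>n. a n - a' n) + 2 * sobolev_sqnorm k (\<lambda>n. b n - b' n)"
    using a b steered_sobolev[OF a'(1)] steered_sobolev[OF b'(1)]
    by (intro sobolev_coeff_add sobolev_coeff_diff) (auto simp: steered_closure_def)
  then have "sobolev_sqnorm k (\<lambda>n. (a n + b n) - (a' n + b' n)) < \<epsilon>"
    using a'(2) b'(2) by (simp add: algebra_simps)
  with steered_add[OF a'(1) b'(1)]
  show "\<exists>d\<in>steered \<omega> k. sobolev_sqnorm k (\<lambda>n. (a n + b n) - d n) < \<epsilon>" by (intro bexI)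
qed

lemma steered_closure_cmult:
  assumes a: "a \<in> steered_closure \<omega> k"
  shows "(\<lambda>n. x * a n) \<in> steered_closure \<omega> k"
  unfolding steered_closure_def
proof (intro CollectI conjI allI impI)
  show "sobolev_coeff k (\<lambda>n. x * a n)"
    using a by (auto simp: steered_closure_def intro: sobolev_coeff_cmult)
  fix \<epsilon> :: real assume e: "\<epsilon> > 0"
  have x: "(cmod x)\<^sup>2 + 1 > 0" by (intro add_nonneg_pos) auto
  have "\<epsilon> / ((cmod x)\<^sup>2 + 1) > 0" using e x by simp
  then obtain a' where a': "a' \<in> steered \<omega> k" "sobolev_sqnorm k (\<lambda>n. a n - a' n) < \<epsilon> / ((cmod x)\<^sup>2 + 1)"
    using a unfolding steered_closure_def by blast
  have d: "sobolev_coeff k (\<lambda>n. a n - a' n)"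
    using a steered_sobolev[OF a'(1)] by (intro sobolev_coeff_diff) (auto simp: steered_closure_def)
  have nn: "sobolev_sqnorm k (\<lambda>n. a n - a' n) \<ge> 0"
    unfolding sobolev_sqnorm_def by (rule infsum_nonneg) auto
  have "sobolev_sqnorm k (\<lambda>n. x * (a n - a' n)) = (cmod x)\<^sup>2 * sobolev_sqnorm k (\<lambda>n. a n - a' n)"
    by (rule sobolev_coeff_cmult[OF d])
  also have "\<dots> \<le> ((cmod x)\<^sup>2 + 1) * sobolev_sqnorm k (\<lambda>n. a n - a' n)"
    using nn by (intro mult_right_mono) auto
  also have "\<dots> < \<epsilon>" using a'(2) x by (simp add: pos_less_divide_eq mult.commute)
  finally have "sobolev_sqnorm k (\<lambda>n. x * a n - x * a' n) < \<epsilon>" by (simp add: right_diff_distrib)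
  with steered_cmult[OF a'(1)]
  show "\<exists>d\<in>steered \<omega> k. sobolev_sqnorm k (\<lambda>n. x * a n - d n) < \<epsilon>" by (intro bexI)
qed

lemma steered_closure_cnj:
  assumes a: "a \<in> steered_closure \<omega> k"
  shows "(\<lambda>n. cnj (a (- n))) \<in> steered_closure \<omega> k"
  unfolding steered_closure_def
proof (intro CollectI conjI allI impI)
  show "sobolev_coeff k (\<lambda>n. cnj (a (- n)))"
    using a by (simp add: steered_closure_def sobolev_coeff_cnj)
  fix \<epsilon> :: real assume "\<epsilon> > 0"
  then obtain a' where a': "a' \<in> steered \<omega> k" "sobolev_sqnorm k (\<lambda>n. a n - a' n) < \<epsilon>"
    using a unfolding steered_closure_def by blast
  have "sobolev_sqnorm k (\<lambda>n. cnj (a (- n)) - cnj (a' (- n))) < \<epsilon>"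
    using a'(2) sobolev_coeff_cnj(2)[of k "\<lambda>n. a n - a' n"] by simp
  with steered_cnj[OF a'(1)]
  show "\<exists>d\<in>steered \<omega> k. sobolev_sqnorm k (\<lambda>n. cnj (a (- n)) - d n) < \<epsilon>" by (intro bexI)
qed

text \<open>Truncations to finite sets of frequencies converge in the weighted norm. Asking only for
  frequencies present in \<open>a\<close> allows an application to a sequence vanishing at 0 before
  frequency 0 itself is known to be in the closure.\<close>

lemma steered_closure_of_singles:
  assumes a: "sobolev_coeff k a"
    and single: "\<And>m. a m \<noteq> 0 \<Longrightarrow> (\<lambda>n. if n = m then 1 else 0) \<in> steered_closure \<omega> k"
  shows "a \<in> steered_closure \<omega> k"
proof (rule steered_closure_limit[OF a])
  fix \<epsilon> :: real assume e: "\<epsilon> > 0"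
  let ?f = "\<lambda>n. (1 + (real_of_int n)\<^sup>2) ^ k * (cmod (a n))\<^sup>2"
  have fin: "(\<lambda>n. if n \<in> F then a n else 0) \<in> steered_closure \<omega> k" if "finite F" for F
    using that
  proof induction
    case empty
    show ?case by (simp add: steered_in_closure steered_zero)
  next
    case (insert m F)
    have "(\<lambda>n. a m * (if n = m then 1 else 0)) \<in> steered_closure \<omega> k"
    proof (cases "a m = 0")
      case True
      then show ?thesis by (simp add: steered_in_closure steered_zero)
    next
      case False
      then show ?thesis by (intro steered_closure_cmult single)
    qed
    from steered_closure_add[OF this insert.IH] show ?case
      by (rule back_subst[of "\<lambda>a. a \<in> steered_closure \<omega> k"]) (use insert.hyps in auto)
  qed
  have s: "?f summable_on UNIV" using a by (simp add: sobolev_coeff_def)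
  have "(sum ?f \<longlongrightarrow> infsum ?f UNIV) (finite_subsets_at_top UNIV)"
    using has_sum_infsum[OF s] unfolding has_sum_def .
  then have "\<forall>\<^sub>F F in finite_subsets_at_top UNIV. dist (sum ?f F) (infsum ?f UNIV) < \<epsilon>"
    using e by (rule tendstoD)
  then obtain F where F: "finite F" "dist (sum ?f F) (infsum ?f UNIV) < \<epsilon>"
    unfolding eventually_finite_subsets_at_top by blast
  have "sobolev_sqnorm k (\<lambda>n. a n - (if n \<in> F then a n else 0)) = infsum ?f (UNIV - F)"
    unfolding sobolev_sqnorm_def by (rule infsum_cong_neutral) auto
  also have "\<dots> = infsum ?f UNIV - infsum ?f F"
    by (rule infsum_Diff) (use s F in \<open>auto intro: summable_on_finite\<close>)
  also have "\<dots> < \<epsilon>" using F by (simp add: dist_real_def)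
  finally show "\<exists>b\<in>steered_closure \<omega> k. sobolev_sqnorm k (\<lambda>n. a n - b n) < \<epsilon>"
    using fin[OF F(1)] by (intro bexI)
qed

lemma bump_eq_0: "Re z \<le> c \<Longrightarrow> p \<noteq> 0 \<Longrightarrow> bump c p z = 0"
  by (simp add: bump_def zero_power)

lemma dbump_eq_0: "Re z \<le> c \<Longrightarrow> 2 \<le> p \<Longrightarrow> dbump c p z = 0"
  by (simp add: dbump_def zero_power)

text \<open>Decay of order \<open>k + 2\<close> requires exponent \<open>2 * (k + 2) + 1\<close> for
  \<open>bump\<close> and \<open>2 * (k + 2) + 3 = 2 * k + 7\<close> for \<open>dbump\<close>; one
  \<open>p\<close> serves both.\<close>

lemma angular_pair_bump:
  assumes arc: "\<And>z. cmod z = 1 \<Longrightarrow> cos h < Re (z * cnj w) \<Longrightarrow> z \<in> \<omega>"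
    and w: "cmod w = 1" and h: "h \<le> pi" "0 \<le> \<delta>" "\<delta> \<le> h / 2"
    and \<Phi>: "continuous_on (sphere 0 1) \<Phi>"
    and \<Phi>0: "\<And>z. cmod z = 1 \<Longrightarrow> Re (z * cnj w) \<le> cos (h / 2) \<Longrightarrow> \<Phi> z = 0"
    and p: "p = 2 * k + 7"
  shows "\<exists>v. angular_pair \<omega> k (circle_conv \<Phi> (bump (cos \<delta>) p)) v"
    and "\<exists>v. angular_pair \<omega> k (circle_conv \<Phi> (dbump (cos \<delta>) p)) v"
proof -
  let ?c = "cos \<delta>"
  obtain C1 where C1: "\<And>n. (1 + (real_of_int n)\<^sup>2) ^ Suc (Suc k) * cmod (fourier_coeff (bump ?c p) n) \<le> C1"
    using fourier_coeff_bump_decay[of "Suc (Suc k)" p ?c] p by auto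
  obtain C2 where C2: "\<And>n. (1 + (real_of_int n)\<^sup>2) ^ Suc (Suc k) * cmod (fourier_coeff (dbump ?c p) n) \<le> C2"
    using fourier_coeff_dbump_decay[of "Suc (Suc k)" p ?c] p by auto
  have "angular_pair \<omega> k (circle_conv \<Phi> (bump ?c p)) (circle_conv \<Phi> (second_deriv_comb (bump ?c) ?c p))"
    using p by (intro angular_pair_circle_conv[OF arc w h \<Phi> \<Phi>0 _ _ _ _ _ C1] continuous_on_bump
        continuous_on_second_deriv_comb fourier_coeff_bump_second)
      (auto simp: second_deriv_comb_def bump_eq_0)
  then show "\<exists>v. angular_pair \<omega> k (circle_conv \<Phi> (bump ?c p)) v" by blast
  have "angular_pair \<omega> k (circle_conv \<Phi> (dbump ?c p)) (circle_conv \<Phi> (second_deriv_comb (dbump ?c) ?c p))"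
    using p by (intro angular_pair_circle_conv[OF arc w h \<Phi> \<Phi>0 _ _ _ _ _ C2] continuous_on_dbump
        continuous_on_second_deriv_comb fourier_coeff_dbump_second)
      (auto simp: second_deriv_comb_def dbump_eq_0)
  then show "\<exists>v. angular_pair \<omega> k (circle_conv \<Phi> (dbump ?c p)) v" by blast
qed

lemma positive_frequency_in_closure:
  assumes arc: "\<And>z. cmod z = 1 \<Longrightarrow> cos h < Re (z * cnj w) \<Longrightarrow> z \<in> \<omega>"
    and w: "cmod w = 1" and h: "0 < h" "h < pi" and m: "m > 0"
  shows "(\<lambda>n. if n = int m then 1 else 0) \<in> steered_closure \<omega> k"
proof -
  \<comment> \<open>The first bound keeps the support in the arc. The second makes
    \<open>cos (m * t)\<close> nonnegative on the bump, so that its coefficient at \<open>m\<close>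
    is nonzero.\<close>
  define \<delta> where "\<delta> = min (h / 2) (pi / (2 * real m))"
  have \<delta>: "0 < \<delta>" "\<delta> \<le> h / 2" "real m * \<delta> \<le> pi / 2" "\<delta> \<le> pi"
    using h m by (auto simp: \<delta>_def min_def field_simps)
  define p where "p = 2 * k + 7"
  define \<rho> where "\<rho> = fourier_coeff (bump (cos \<delta>) p)"
  define \<sigma> where "\<sigma> = fourier_coeff (dbump (cos \<delta>) p)"
  have \<sigma>: "\<sigma> n = \<i> * of_int n * \<rho> n" for n
    using p_def by (simp add: \<sigma>_def \<rho>_def fourier_coeff_dbump)
  have "cos \<delta> < cos 0" using \<delta> by (intro cos_monotone_0_pi) auto
  moreover have "0 \<le> Re (z powi int m)" if z: "cmod z = 1" "cos \<delta> < Re z" for z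
  proof -
    obtain t where t: "\<bar>t\<bar> < \<delta>" "z = cis t"
      using circle_cap_cis[OF z(1) _ \<delta>(4) z(2)] \<delta>(1) by auto
    have "real m * \<bar>t\<bar> \<le> real m * \<delta>" using t(1) by (intro mult_left_mono) auto
    then have "\<bar>real m * t\<bar> \<le> pi / 2" using \<delta>(3) by (simp add: abs_mult)
    then have "0 \<le> cos (real m * t)" by (intro cos_ge_zero) auto
    then show ?thesis by (simp only: t cis_powi of_int_of_nat_eq cis.sel)
  qed
  ultimately have "Re (\<rho> (int m)) > 0"
    unfolding \<rho>_def by (intro Re_fourier_coeff_bump_pos) (auto simp: p_def)
  then have \<rho>0: "\<rho> (int m) \<noteq> 0" by auto
  \<comment> \<open>The approximants converge to this multiple of the pure frequency; the nonzero
    factor is divided out at the end.\<close>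
  define a where "a n = (if n = int m then of_nat m * \<rho> (int m) else 0)" for n

  obtain C where "\<And>n. (1 + (real_of_int n)\<^sup>2) ^ Suc k * cmod (\<sigma> n) \<le> C"
    using fourier_coeff_dbump_decay[of "Suc k" p "cos \<delta>"] p_def unfolding \<sigma>_def by auto
  then have s\<sigma>: "sobolev_coeff k \<sigma>" by (rule decay_imp_sobolev(2))
  have "cmod (a n) \<le> cmod (\<sigma> n)" for n
    by (auto simp: a_def \<sigma> norm_mult)
  then have sa: "sobolev_coeff k a" by (rule sobolev_coeff_mono(1)[OF s\<sigma>])
  have "a \<in> steered_closure \<omega> k"
  proof (rule steered_closure_limit[OF sa])
    fix \<epsilon> :: real assume \<epsilon>: "\<epsilon> > 0"
    define S where "S = sobolev_sqnorm k \<sigma>"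
    have S: "S \<ge> 0" unfolding S_def sobolev_sqnorm_def by (rule infsum_nonneg) auto
    \<comment> \<open>Chosen so that \<open>e\<^sup>2 * S < \<epsilon>\<close>; the added 1 also
      covers \<open>S = 0\<close>.\<close>
    define e where "e = sqrt (\<epsilon> / (S + 1))"
    have e: "e > 0" "e\<^sup>2 = \<epsilon> / (S + 1)" using \<epsilon> S by (auto simp: e_def)
    have ch: "cos (h / 2) < 1" using cos_monotone_0_pi[of 0 "h / 2"] h by simp
    obtain \<Phi> where \<Phi>: "continuous_on (sphere 0 1) \<Phi>"
        "\<And>z. cmod z = 1 \<Longrightarrow> Re (z * cnj w) \<le> cos (h / 2) \<Longrightarrow> \<Phi> z = 0"
        and ap: "\<And>n. n \<ge> 0 \<Longrightarrow> cmod (fourier_coeff \<Phi> n - (if n = int m then 1 else 0)) \<le> e"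
      using one_sided_approximation[OF w ch e(1), of m] by blast
    have m\<Phi>: "\<Phi> \<in> borel_measurable circle_measure" by (rule borel_measurable_circleI[OF \<Phi>(1)])
    obtain A where A: "\<And>z. cmod z = 1 \<Longrightarrow> cmod (\<Phi> z) \<le> A"
      using continuous_bounded_circle[OF \<Phi>(1)] by blast
    let ?w0 = "\<lambda>z. - (1 / 2) * circle_conv \<Phi> (bump (cos \<delta>) p) z"
    let ?w1 = "\<lambda>z. - (\<i> / 2) * circle_conv \<Phi> (dbump (cos \<delta>) p) z"
    define b where "b = steered_coeff ?w0 ?w1"
    have hp: "h \<le> pi" "0 \<le> \<delta>" using h \<delta> by auto
    note ex = angular_pair_bump[OF arc w hp \<delta>(2) \<Phi> p_def]
    obtain v0 v1 where "angular_pair \<omega> k (circle_conv \<Phi> (bump (cos \<delta>) p)) v0"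
      "angular_pair \<omega> k (circle_conv \<Phi> (dbump (cos \<delta>) p)) v1"
      using ex by blast
    then have b: "b \<in> steered \<omega> k"
      unfolding b_def steered_def by (blast intro: angular_pair_cmult)
    \<comment> \<open>The two contributions are \<open>n / 2\<close> and
      \<open>\<bar>n\<bar> / 2\<close>. They cancel exactly for \<open>n < 0\<close>, where the
      coefficients of \<Phi> are not controlled.\<close>
    have bn: "b n = of_int (max n 0) * \<rho> n * fourier_coeff \<Phi> n" for n
    proof -
      have "b n = - (\<i> / 2) * (fourier_coeff \<Phi> n * \<sigma> n) + of_int \<bar>n\<bar> * (1 / 2) * (fourier_coeff \<Phi> n * \<rho> n)"
        unfolding b_def steered_coeff_def fourier_coeff_cmult \<rho>_def \<sigma>_def
        by (simp add: fourier_coeff_circle_conv[OF m\<Phi> A] continuous_on_bump continuous_on_dbump)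
      also have "\<dots> = (of_int n / 2 + of_int \<bar>n\<bar> / 2) * \<rho> n * fourier_coeff \<Phi> n"
        by (simp add: \<sigma> algebra_simps)
      also have "(of_int n / 2 + of_int \<bar>n\<bar> / 2 :: complex) = of_int (max n 0)"
        by (cases "n \<ge> 0") auto
      finally show ?thesis .
    qed
    \<comment> \<open>The uniform error \<open>e\<close> on the coefficients of \<Phi> is multiplied
      by \<open>n * \<rho> n\<close>, which has the modulus of \<open>\<sigma> n\<close>, a sequence
      of finite weighted norm.\<close>
    have le: "cmod (a n - b n) \<le> cmod (of_real e * \<sigma> n)" for n
    proof (cases "n \<ge> 0")
      case True
      have "a n - b n = - (of_int n * \<rho> n * (fourier_coeff \<Phi> n - (if n = int m then 1 else 0)))"
        using True by (auto simp: a_def bn algebra_simps)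
      also have "cmod \<dots> = cmod (\<sigma> n) * cmod (fourier_coeff \<Phi> n - (if n = int m then 1 else 0))"
        by (simp only: norm_minus_cancel norm_mult \<sigma> norm_ii mult_1)
      also have "\<dots> \<le> cmod (\<sigma> n) * e"
        by (intro mult_left_mono ap True) auto
      finally show ?thesis using e by (simp add: norm_mult mult.commute)
    qed (auto simp: a_def bn)
    have "sobolev_sqnorm k (\<lambda>n. a n - b n) \<le> sobolev_sqnorm k (\<lambda>n. of_real e * \<sigma> n)"
      by (rule sobolev_coeff_mono(2)[OF sobolev_coeff_cmult(1)[OF s\<sigma>] le])
    also have "\<dots> = e\<^sup>2 * S"
      using sobolev_coeff_cmult(2)[OF s\<sigma>] by (simp add: S_def)
    also have "\<dots> < \<epsilon>"
      unfolding e(2) using \<epsilon> S by (simp add: field_simps)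
    finally show "\<exists>b\<in>steered_closure \<omega> k. sobolev_sqnorm k (\<lambda>n. a n - b n) < \<epsilon>"
      using steered_in_closure[OF b] by (intro bexI)
  qed
  from steered_closure_cmult[OF this, of "1 / (of_nat m * \<rho> (int m))"]
  show ?thesis
    by (rule back_subst[of "\<lambda>a. a \<in> steered_closure \<omega> k"]) (use \<rho>0 m in \<open>auto simp: a_def fun_eq_iff\<close>)
qed

text \<open>Positive frequencies are at hand and negative ones follow by reflection. For frequency
  0, a steered sequence with \<open>b 0 \<noteq> 0\<close> is freed of its other frequencies, all of
  which already lie in the closure, and rescaled.\<close>

lemma frequency_in_closure:
  assumes arc: "\<And>z. cmod z = 1 \<Longrightarrow> cos h < Re (z * cnj w) \<Longrightarrow> z \<in> \<omega>"
    and w: "cmod w = 1" and h: "0 < h" "h < pi"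
  shows "(\<lambda>n. if n = m then 1 else 0) \<in> steered_closure \<omega> k"
proof -
  have pos: "(\<lambda>n. if n = m then 1 else 0) \<in> steered_closure \<omega> k" if "m > 0" for m
    using positive_frequency_in_closure[OF arc w h, of "nat m"] that by simp
  have nz: "(\<lambda>n. if n = m then 1 else 0) \<in> steered_closure \<omega> k" if "m \<noteq> 0" for m
  proof (cases "m > 0")
    case False
    have "(\<lambda>n. if n = - m then 1 else 0) \<in> steered_closure \<omega> k"
      using False that by (intro pos) auto
    from steered_closure_cnj[OF this] show ?thesis
      by (rule back_subst[of "\<lambda>a. a \<in> steered_closure \<omega> k"]) auto
  qed (rule pos)
  show ?thesis
  proof (cases "m = 0")
    case True
    define \<Phi> where "\<Phi> z = bump (cos (h / 2)) 1 (z * cnj w)" for z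
    define p where "p = 2 * k + 7"
    have ch: "cos (h / 2) < 1" using cos_monotone_0_pi[of 0 "h / 2"] h by simp
    have \<Phi>: "continuous_on (sphere 0 1) \<Phi>"
      unfolding \<Phi>_def by (intro continuous_on_compose2[OF continuous_on_bump[of UNIV]] continuous_intros) auto
    have \<Phi>0: "\<Phi> z = 0" if "Re (z * cnj w) \<le> cos (h / 2)" for z
      using that by (simp add: \<Phi>_def bump_eq_0)
    have m\<Phi>: "\<Phi> \<in> borel_measurable circle_measure" by (rule borel_measurable_circleI[OF \<Phi>])
    obtain A where A: "\<And>z. cmod z = 1 \<Longrightarrow> cmod (\<Phi> z) \<le> A"
      using continuous_bounded_circle[OF \<Phi>] by blast
    \<comment> \<open>With \<open>w\<^sub>0 = 0\<close> the sequence consists of the coefficients of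
      a convolution of two nonnegative bumps, whose mean is a product of two nonzero means.\<close>
    define b where "b = steered_coeff (\<lambda>z. 0) (circle_conv \<Phi> (bump (cos (h / 2)) p))"
    have hp: "h \<le> pi" "0 \<le> h / 2" "h / 2 \<le> h / 2" using h by auto
    obtain v where "angular_pair \<omega> k (circle_conv \<Phi> (bump (cos (h / 2)) p)) v"
      using angular_pair_bump(1)[OF arc w hp \<Phi> \<Phi>0 p_def] by blast
    then have b: "b \<in> steered \<omega> k"
      unfolding b_def steered_def using angular_pair_zero by blast
    have "b 0 = fourier_coeff (bump (cos (h / 2)) 1) 0 * fourier_coeff (bump (cos (h / 2)) p) 0"
    proof -
      have "fourier_coeff \<Phi> 0 = fourier_coeff (bump (cos (h / 2)) 1) 0"
        unfolding \<Phi>_def using fourier_coeff_rotate[OF continuous_on_bump w, of "cos (h / 2)" 1 0] by simp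
      then show ?thesis
        by (simp add: b_def steered_coeff_def fourier_coeff_circle_conv[OF m\<Phi> A continuous_on_bump])
    qed
    moreover have "fourier_coeff (bump (cos (h / 2)) q) 0 \<noteq> 0" if "q \<noteq> 0" for q
      using Re_fourier_coeff_bump_pos[of "cos (h / 2)" 0 q] that ch by auto
    ultimately have b0: "b 0 \<noteq> 0" by (simp add: p_def)
    define b' where "b' n = (if n = 0 then 0 else b n)" for n
    have sb': "sobolev_coeff k b'"
      by (rule sobolev_coeff_mono(1)[OF steered_sobolev[OF b]]) (simp add: b'_def)
    have "b' \<in> steered_closure \<omega> k"
      by (rule steered_closure_of_singles[OF sb' nz]) (auto simp: b'_def)
    from steered_closure_cmult[OF steered_closure_add[OF steered_in_closure[OF b]
          steered_closure_cmult[OF this, of "- 1"]], of "1 / b 0"]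
    show ?thesis
      by (rule back_subst[of "\<lambda>a. a \<in> steered_closure \<omega> k"])
        (use b0 True in \<open>auto simp: b'_def fun_eq_iff\<close>)
  qed (rule nz)
qed

section \<open>Back from coefficient sequences to functions\<close>

lemma L2_circle_integrable:
  assumes "f \<in> L2 circle_measure"
  shows "integrable circle_measure f"
proof (rule Bochner_Integration.integrable_bound)
  show "integrable circle_measure (\<lambda>z. 1 + (cmod (f z))\<^sup>2)"
    using assms by (auto simp: L2_def)
  show "f \<in> borel_measurable circle_measure" using assms by (simp add: L2_def)
  have "cmod (f z) \<le> 1 + (cmod (f z))\<^sup>2" for z
    using sum_squares_bound[of "cmod (f z)" 1] by simp (smt (verit) norm_ge_zero)
  then show "AE z in circle_measure. norm (f z) \<le> norm (1 + (cmod (f z))\<^sup>2)"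
    by (intro AE_I2) (simp add: add_nonneg_nonneg)
qed

lemma sobolev_norm_eq:
  assumes "sobolev_coeff k (fourier_coeff f)"
  shows "sobolev_norm k f = sqrt (sobolev_sqnorm k (fourier_coeff f))"
proof -
  let ?f = "\<lambda>n. (1 + (real_of_int n)\<^sup>2) ^ k * (cmod (fourier_coeff f n))\<^sup>2"
  have "((\<lambda>n. complex_of_real (?f n)) has_sum of_real (infsum ?f UNIV)) UNIV"
    using assms unfolding sobolev_coeff_def by (intro has_sum_of_real has_sum_infsum)
  moreover have "complex_of_real (?f n) = (1 + of_int n ^ 2) ^ k * fourier_coeff f n * cnj (fourier_coeff f n)" for n
    by (simp only: of_real_mult complex_norm_square) simp
  ultimately have "sobolev_inner k f f = of_real (infsum ?f UNIV)"
    unfolding sobolev_inner_def by (simp only: infsumI)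
  then show ?thesis by (simp add: sobolev_norm_def sobolev_sqnorm_def)
qed

theorem corollary1p14:
  fixes \<omega> :: "complex set" and T :: real and k :: nat
  assumes "open_strict_arc \<omega>" and "T > 0"
  shows "dense_in_sobolev k (null_controllable_L2 \<omega> T \<inter> sobolev k)"
  unfolding dense_in_sobolev_def
proof (intro conjI ballI allI impI)
  show "null_controllable_L2 \<omega> T \<inter> sobolev k \<subseteq> sobolev k" by blast
  fix f and \<epsilon> :: real assume f: "f \<in> sobolev k" and \<epsilon>: "0 < \<epsilon>"
  obtain w h where w: "cmod w = 1" and h: "0 < h" "h < pi" and \<omega>: "\<omega> \<in> sets circle_measure"
    and arc: "\<And>z. cmod z = 1 \<Longrightarrow> cos h < Re (z * cnj w) \<Longrightarrow> z \<in> \<omega>"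
    using open_strict_arc_cap[OF assms(1)] by metis
  have sf: "sobolev_coeff k (fourier_coeff f)" and fi: "integrable circle_measure f"
    using f by (auto simp: sobolev_def sobolev_coeff_def L2_circle_integrable)
  have "fourier_coeff f \<in> steered_closure \<omega> k"
    by (rule steered_closure_of_singles[OF sf frequency_in_closure[OF arc w h]])
  moreover have "\<epsilon>\<^sup>2 > 0" using \<epsilon> by simp
  ultimately obtain b where b: "b \<in> steered \<omega> k" "sobolev_sqnorm k (\<lambda>n. fourier_coeff f n - b n) < \<epsilon>\<^sup>2"
    unfolding steered_closure_def by blast
  then obtain w0 v0 w1 v1 where p: "angular_pair \<omega> k w0 v0" "angular_pair \<omega> k w1 v1"
    and bw: "b = steered_coeff w0 w1" by (auto simp: steered_def)
  \<comment> \<open>The function rebuilt from \<open>b\<close> is controllable and has coefficients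
    \<open>b\<close>, so the Sobolev error can be read off the sequences.\<close>
  let ?g = "fourier_series b"
  have g: "?g \<in> null_controllable_L2 \<omega> T \<inter> sobolev k" "\<And>n. fourier_coeff ?g n = b n"
    using steered_data_null_controllable[OF \<omega> assms(2) p] unfolding bw by auto
  have "integrable circle_measure ?g"
    using g(1) by (auto simp: sobolev_def intro: L2_circle_integrable)
  then have c: "fourier_coeff (\<lambda>z. f z - ?g z) = (\<lambda>n. fourier_coeff f n - b n)"
    by (simp add: fun_eq_iff fourier_coeff_diff fi g(2))
  have "sobolev_norm k (\<lambda>z. f z - ?g z) = sqrt (sobolev_sqnorm k (\<lambda>n. fourier_coeff f n - b n))"
    using sobolev_norm_eq[of k "\<lambda>z. f z - ?g z"] sobolev_coeff_diff[OF sf steered_sobolev[OF b(1)]]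
    by (simp add: c)
  also have "\<dots> < \<epsilon>"
    using real_sqrt_less_mono[OF b(2)] \<epsilon> by simp
  finally show "\<exists>g\<in>null_controllable_L2 \<omega> T \<inter> sobolev k. sobolev_norm k (\<lambda>z. f z - g z) < \<epsilon>"
    using g(1) by blast
qed

end
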